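(* Let $\alpha\in(0,1]$. Then $\mathcal C^{1,\alpha}\subset\mathcal H$ if and only if $\alpha>1/2$. (That is: $\alpha>1/2$ if and only if every $h\in\mathcal C^{1,\alpha}$ fixing $-1,\mathrm i,1$ has shear coordinate $s_h\in\mathcal H$.)
   Context: $\mathcal C^{1,\alpha}$ is the class of orientation-preserving homeomorphisms $h$ of the unit circle $\mathbb T$ such that $\log h'$ is $\alpha$-Hölder continuous on $\mathbb T$; equivalently, $h\in C^{1,\alpha}$ and $\inf_{\mathbb T}|h'|>0$. All circle homeomorphisms are normalized (by post-composition with a Möbius transformation of $\mathbb T$) to fix $-1,\mathrm i,1$. Farey tessellation: $\mathbb D$ is the unit disk with its hyperbolic metric, and $(a,b)$ denotes the unoriented hyperbolic geodesic with endpoints $a\ne b\in\mathbb T$. The Farey tessellation $\mathfrak F$ is the ideal triangulation of $\mathbb D$ obtained from the ideal triangle with vertices $1,\mathrm i,-1$ by repeated hyperbolic reflections across edges; $V$ is its vertex set, $E$ its edge set. For $e\in E$, $Q_e$ is the union of the two triangles of $\mathfrak F$ having $e$ as an edge, with vertices $(a,b,c,d)$ counterclockwise, $e=(a,c)$. For $v\in V$, $\mathrm{fan}(v)$ is the set of edges incident to $v$, indexed $(e_n)_{n\in\mathbb Z}$ so that under a Möbius map $\mathbb D\to\mathbb H$ sending $v$ to $\infty$ the $e_n$ become equally spaced vertical lines with $n$ increasing from left to right. Shears: $s_h(e)=\log\mathrm{cr}(h(a),h(b),h(c),h(d))$ where $Q_e=(a,b,c,d)$, $e=(a,c)$, $\mathrm{cr}(a,b,c,d)=\frac{(b-a)(d-c)}{(c-b)(d-a)}$.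 $\mathcal P$ is the set of $s:E\to\mathbb R$ such that for every $v\in V$, $\mathrm{fan}(v)=(e_n)$, both limits $\lim_n\sum_{k=-n}^{-1}s(e_k)$ and $\lim_n\sum_{k=0}^n s(e_k)$ exist in $\mathbb R$. For $s\in\mathcal P$ and $e\in\mathrm{fan}(v)$, $p_{s,v}(e\pm)$ is the sum of $s(e')$ over $e'\in\mathrm{fan}(v)$ of strictly larger ($+$) or strictly smaller ($-$) index than $e$. For $e=(a,b)\in E$, $\Psi(s)(e)=\frac14(p_{s,a}(e-)-p_{s,a}(e+)+p_{s,b}(e-)-p_{s,b}(e+))$. $\mathcal H=\{s\in\mathcal P:\sum_{e\in E}\Psi(s)(e)^2<\infty\}$, and $h\in\mathcal H$ means $s_h\in\mathcal H$. *)

theory Defs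
  imports "HOL-Analysis.Analysis"
begin

section \<open>Circle homeomorphisms of class C(1,alpha)\<close>

abbreviation unit_circle :: "complex set" where
  "unit_circle \<equiv> sphere 0 1"

definition circle_homeo_op :: "(complex \<Rightarrow> complex) \<Rightarrow> bool" where
  "circle_homeo_op h \<longleftrightarrow>
     (\<exists>g. homeomorphism unit_circle unit_circle h g) \<and>
     (\<exists>\<phi>. continuous_on UNIV \<phi> \<and> strict_mono \<phi> \<and> (\<forall>t::real. h (cis t) = cis (\<phi> t)))"

definition holder_on :: "real \<Rightarrow> complex set \<Rightarrow> (complex \<Rightarrow> complex) \<Rightarrow> bool" where
  "holder_on \<alpha> S f \<longleftrightarrow> (\<exists>C. \<forall>z\<in>S. \<forall>w\<in>S. dist (f z) (f w) \<le> C * dist z w powr \<alpha>)"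

text \<open>Here \<open>h'\<close> is the complex derivative of \<open>h\<close> along the circle, and \<open>L\<close> is a continuous
  branch of \<open>log h'\<close>. Writing \<open>h (cis t) = cis (\<phi> t)\<close>, one has
  \<open>L = ln (\<phi>' t) + \<i> (\<phi> t - t)\<close> up to a constant in \<open>2 \<pi> \<i> \<int>\<close>; the imaginary part is
  continuously differentiable, so this is the same condition as Hoelder continuity of the
  logarithm of the angular derivative.\<close>

definition C1_circle :: "real \<Rightarrow> (complex \<Rightarrow> complex) set" where
  "C1_circle \<alpha> = {h. circle_homeo_op h \<and>
     (\<exists>L. (\<forall>z\<in>unit_circle. (h has_field_derivative exp (L z)) (at z within unit_circle)) \<and>
          holder_on \<alpha> unit_circle L)}"

definition normalized :: "(complex \<Rightarrow> complex) \<Rightarrow> bool" where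
  "normalized h \<longleftrightarrow> h (-1) = -1 \<and> h \<i> = \<i> \<and> h 1 = 1"

section \<open>The Farey tessellation\<close>

text \<open>Hyperbolic reflection across the geodesic with endpoints \<open>a \<noteq> b\<close> on the circle: Euclidean
  reflection if the geodesic is a diameter, otherwise inversion in the circle through \<open>a\<close> and \<open>b\<close>
  orthogonal to the unit circle, whose centre is \<open>c = 2 a b / (a + b)\<close> and whose squared radius
  is \<open>cmod c ^ 2 - 1\<close>.\<close>

definition hyp_reflection :: "complex \<Rightarrow> complex \<Rightarrow> complex \<Rightarrow> complex" where
  "hyp_reflection a b z =
     (if a + b = 0 then a\<^sup>2 * cnj z
      else let c = 2 * a * b / (a + b) in c + of_real ((cmod c)\<^sup>2 - 1) / cnj (z - c))"

lemma hyp_reflection_on_circle: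
  assumes "cmod a = 1" "cmod b = 1" "a \<noteq> b" "cmod z = 1"
  shows "hyp_reflection a b z = (2 * a * b - (a + b) * z) / (a + b - 2 * z)"
proof -
  have inv: "cnj x = 1 / x" if "cmod x = 1" for x :: complex
    using that by (metis complex_cnj_divide complex_cnj_one complex_div_cnj div_by_1 mult_1
        of_real_1 power_one)
  have nz: "a \<noteq> 0" "b \<noteq> 0" "z \<noteq> 0" using assms by auto
  have den: "a + b - 2 * z \<noteq> 0"
  proof
    assume "a + b - 2 * z = 0"
    then have z: "a + b = 2 * z" by simp
    have "1 / a + 1 / b = cnj (a + b)" using inv assms by simp
    also have "\<dots> = 2 / z" unfolding z using inv assms by simp
    finally have "(a + b) * z = 2 * a * b" using nz by (simp add: field_simps)
    then have "(a + b) * (2 * z) = 2 * (2 * a * b)" by (metis mult.left_commute)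
    then have "(a + b) * (a + b) = 4 * a * b" unfolding z[symmetric] by simp
    then have "(a - b)\<^sup>2 = 0" by (simp add: power2_eq_square algebra_simps)
    with \<open>a \<noteq> b\<close> show False by simp
  qed
  show ?thesis
  proof (cases "a + b = 0")
    case True
    then have "b = - a" by (simp add: add_eq_0_iff)
    with nz inv[OF assms(4)] show ?thesis
      by (simp add: hyp_reflection_def power2_eq_square)
  next
    case False
    define c where "c = 2 * a * b / (a + b)"
    have "cnj c = 2 * (1 / a) * (1 / b) / (1 / a + 1 / b)"
      using inv assms by (simp add: c_def)
    also have "\<dots> = 2 / (a + b)" using nz False by (simp add: field_simps)
    finally have cc: "cnj c = 2 / (a + b)" .
    have r: "of_real ((cmod c)\<^sup>2 - 1) = (4 * a * b - (a + b)\<^sup>2) / (a + b)\<^sup>2"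
    proof -
      have "of_real ((cmod c)\<^sup>2 - 1) = c * cnj c - 1"
        using complex_norm_square[of c] by simp
      also have "\<dots> = 4 * a * b / (a + b)\<^sup>2 - 1"
        unfolding cc by (simp add: c_def power2_eq_square)
      also have "\<dots> = (4 * a * b - (a + b)\<^sup>2) / (a + b)\<^sup>2"
        using False by (simp add: diff_divide_distrib)
      finally show ?thesis .
    qed
    have d: "cnj (z - c) = (a + b - 2 * z) / (z * (a + b))"
    proof -
      have "cnj (z - c) = 1 / z - 2 / (a + b)" using cc inv[OF assms(4)] by simp
      also have "\<dots> = (a + b - 2 * z) / (z * (a + b))"
        using nz False by (simp add: diff_frac_eq)
      finally show ?thesis .
    qed
    have "hyp_reflection a b z = c + of_real ((cmod c)\<^sup>2 - 1) / cnj (z - c)"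
      using False by (simp add: hyp_reflection_def c_def Let_def)
    also have "\<dots> = 2 * a * b / (a + b) + (4 * a * b - (a + b)\<^sup>2) * z / ((a + b) * (a + b - 2 * z))"
      unfolding r d using False nz den by (simp add: c_def power2_eq_square)
    also have "\<dots> = (2 * a * b * (a + b - 2 * z) + (4 * a * b - (a + b)\<^sup>2) * z) / ((a + b) * (a + b - 2 * z))"
      using False den by (simp add: add_divide_distrib)
    also have "2 * a * b * (a + b - 2 * z) + (4 * a * b - (a + b)\<^sup>2) * z
        = (a + b) * (2 * a * b - (a + b) * z)"
      by (simp add: algebra_simps power2_eq_square)
    finally show ?thesis using False by simp
  qed
qed

text \<open>Ideal triangles are represented by their sets of three vertices, and unoriented geodesics by
  their sets of two endpoints.\<close>

inductive_set farey_triangles :: "complex set set" where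
  base: "{1, \<i>, -1} \<in> farey_triangles"
| reflect: "\<lbrakk>T \<in> farey_triangles; a \<in> T; b \<in> T; a \<noteq> b\<rbrakk>
             \<Longrightarrow> hyp_reflection a b ` T \<in> farey_triangles"

definition farey_vertices :: "complex set" where
  "farey_vertices = \<Union> farey_triangles"

definition farey_edges :: "complex set set" where
  "farey_edges = {{a, b} |a b. a \<noteq> b \<and> (\<exists>T\<in>farey_triangles. a \<in> T \<and> b \<in> T)}"

definition ccw4 :: "complex \<Rightarrow> complex \<Rightarrow> complex \<Rightarrow> complex \<Rightarrow> bool" where
  "ccw4 a b c d \<longleftrightarrow> (\<exists>t\<^sub>1 t\<^sub>2 t\<^sub>3 t\<^sub>4. t\<^sub>1 < t\<^sub>2 \<and> t\<^sub>2 < t\<^sub>3 \<and> t\<^sub>3 < t\<^sub>4 \<and> t\<^sub>4 < t\<^sub>1 + 2 * pi \<and>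
     a = cis t\<^sub>1 \<and> b = cis t\<^sub>2 \<and> c = cis t\<^sub>3 \<and> d = cis t\<^sub>4)"

text \<open>\<open>(a, b, c, d)\<close> are the vertices of \<open>Q\<^sub>e\<close> for \<open>e = {a, c}\<close>; for a given edge there are two such
  labellings, \<open>(a, b, c, d)\<close> and \<open>(c, d, a, b)\<close>.\<close>

definition farey_quad :: "complex \<Rightarrow> complex \<Rightarrow> complex \<Rightarrow> complex \<Rightarrow> bool" where
  "farey_quad a b c d \<longleftrightarrow>
     ccw4 a b c d \<and> {a, b, c} \<in> farey_triangles \<and> {a, c, d} \<in> farey_triangles"

section \<open>Shears\<close>

definition cr :: "complex \<Rightarrow> complex \<Rightarrow> complex \<Rightarrow> complex \<Rightarrow> complex" where
  "cr a b c d = ((b - a) * (d - c)) / ((c - b) * (d - a))"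

lemma cr_rotate2: "cr c d a b = cr a b c d"
proof -
  have "(d - c) * (b - a) / ((a - d) * (b - c)) = ((b - a) * (d - c)) / ((c - b) * (d - a))"
    by (rule arg_cong2[where f = "(/)"]) (simp_all add: algebra_simps)
  then show ?thesis by (simp add: cr_def)
qed

text \<open>The cross-ratio of four points of the circle in counterclockwise order is a positive real,
  so \<open>Re\<close> is only a type conversion. The value does not depend on the labelling of \<open>Q\<^sub>e\<close>, by the
  preceding lemma.\<close>

definition shear :: "(complex \<Rightarrow> complex) \<Rightarrow> complex set \<Rightarrow> real" where
  "shear h e = (THE s. \<exists>a b c d. farey_quad a b c d \<and> e = {a, c} \<and>
     s = ln (Re (cr (h a) (h b) (h c) (h d))))"

section \<open>Fans\<close>

definition fan :: "complex \<Rightarrow> complex set set" where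
  "fan v = {e \<in> farey_edges. v \<in> e}"

text \<open>A Moebius map from the disk to the upper half-plane sending \<open>v\<close> to infinity. Any other such
  map is obtained from it by post-composition with \<open>z \<mapsto> p * z + q\<close> for real \<open>p > 0\<close> and \<open>q\<close>,
  which affects neither the spacing condition nor the order below.\<close>

definition cayley :: "complex \<Rightarrow> complex \<Rightarrow> complex" where
  "cayley v w = \<i> * (v + w) / (v - w)"

definition fan_indexing :: "complex \<Rightarrow> (int \<Rightarrow> complex set) \<Rightarrow> bool" where
  "fan_indexing v f \<longleftrightarrow> bij_betw f UNIV (fan v) \<and>
     (\<exists>x \<delta>::real. \<delta> > 0 \<and>
        (\<forall>n. \<exists>w. w \<noteq> v \<and> f n = {v, w} \<and> cayley v w = of_real (x + of_int n * \<delta>)))"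

text \<open>The indexing is unique up to a shift of \<open>\<int>\<close>; nothing below depends on the choice.\<close>

definition fan_edge :: "complex \<Rightarrow> int \<Rightarrow> complex set" where
  "fan_edge v = (SOME f. fan_indexing v f)"

definition fan_pos :: "complex \<Rightarrow> complex set \<Rightarrow> int" where
  "fan_pos v e = (THE n. fan_edge v n = e)"

section \<open>Square summable diamond shears\<close>

text \<open>Functions on the edge set are total functions on \<open>complex set\<close>; only their values on
  \<open>farey_edges\<close> matter.\<close>

definition shear_P :: "(complex set \<Rightarrow> real) set" where
  "shear_P = {s. \<forall>v\<in>farey_vertices.
     convergent (\<lambda>n::nat. \<Sum>k = - int n..-1. s (fan_edge v k)) \<and>
     convergent (\<lambda>n::nat. \<Sum>k = 0..int n. s (fan_edge v k))}"

definition p_plus :: "(complex set \<Rightarrow> real) \<Rightarrow> complex \<Rightarrow> complex set \<Rightarrow> real" where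
  "p_plus s v e = (\<Sum>k. s (fan_edge v (fan_pos v e + 1 + int k)))"

definition p_minus :: "(complex set \<Rightarrow> real) \<Rightarrow> complex \<Rightarrow> complex set \<Rightarrow> real" where
  "p_minus s v e = (\<Sum>k. s (fan_edge v (fan_pos v e - 1 - int k)))"

definition Psi :: "(complex set \<Rightarrow> real) \<Rightarrow> complex set \<Rightarrow> real" where
  "Psi s e = 1/4 * (\<Sum>v\<in>e. p_minus s v e - p_plus s v e)"

definition shear_H :: "(complex set \<Rightarrow> real) set" where
  "shear_H = {s \<in> shear_P. (\<lambda>e. (Psi s e)\<^sup>2) summable_on farey_edges}"

end

theory Submission
  imports Defs "HOL-Real_Asymp.Real_Asymp"
begin

text \<open>Telescoping the shears in the two fans at the endpoints of an edge \<open>{v, w}\<close> gives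
  \<open>\<Psi> = ln (\<bar>h' v\<bar> * \<bar>h' w\<bar>) / 2 - ln (\<bar>h v - h w\<bar> / \<bar>v - w\<bar>)\<close>, which is \<open>O(\<bar>v - w\<bar> powr \<alpha>)\<close> if
  \<open>ln h'\<close> is \<open>\<alpha>\<close>-Hoelder. The edges are the \<open>{vtx z, vtx w}\<close> for bases \<open>z, w\<close> of determinant 1 of the Gaussian
  integers, with \<open>\<bar>v - w\<bar> = 2 / (\<bar>z\<bar> * \<bar>w\<bar>)\<close>, so that the sum of \<open>\<bar>v - w\<bar> powr (2 * \<alpha>)\<close> over all edges
  converges for \<open>\<alpha> > 1/2\<close>. For \<open>\<alpha> \<le> 1/2\<close>, let \<open>h'\<close> have a square root cusp at the vertex 1: along the fan
  of 1 the squares of \<open>\<Psi>\<close> then decay only like the harmonic series.\<close>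

section \<open>Farey edges as unimodular pairs of Gaussian integers\<close>

text \<open>Both directions rest on one exact formula for \<open>Psi\<close>, valid for every
  positive exponent. Sending a vertex to infinity turns its fan into equally spaced points and the
  shears into differences of logarithms of consecutive image gaps; the tails converge because all
  chords near the vertex are stretched by nearly the same factor. Terms with the other two vertices
  of the quadrilateral cancel between the endpoints of the edge. The obstacle in the sum over all
  edges is that there are infinitely many fans. An edge is coded by three integers, the coordinates
  of its shorter vector and a position in the fan of that vector, and its length is at most a
  constant over the product of their sizes. Three one-variable series then suffice, and the
  threshold is that of a single fan. In the converse, \<open>Psi\<close> compares the average of
  \<open>ln h'\<close> at the two ends with the logarithm of the mean of \<open>h'\<close> over the
  arc. For a square root starting at one end these are, to leading order, 1/2 and 2/3 of the value
  at the other end, so they do not cancel.\<close>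

text \<open>The Gaussian integer \<open>z = p + q \<i>\<close> stands for the rational boundary point \<open>p / q\<close> of the upper
  half-plane, moved to the circle by the Cayley transform: \<open>vtx\<close> doubles the argument of \<open>z\<close>, and
  \<open>1, 1 + \<i>, \<i>\<close> go to \<open>1, \<i>, -1\<close>.\<close>

definition vtx :: "complex \<Rightarrow> complex" where
  "vtx z = z / cnj z"

definition cross :: "complex \<Rightarrow> complex \<Rightarrow> real" where
  "cross z w = Im (cnj z * w)"

lemma cross_eq: "cross z w = Re z * Im w - Im z * Re w"
  by (simp add: cross_def)

definition gauss :: "complex set" where
  "gauss = {z. Re z \<in> \<int> \<and> Im z \<in> \<int>}"

lemma gauss_add: "z \<in> gauss \<Longrightarrow> w \<in> gauss \<Longrightarrow> z + w \<in> gauss"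
  and gauss_diff: "z \<in> gauss \<Longrightarrow> w \<in> gauss \<Longrightarrow> z - w \<in> gauss"
  and gauss_minus: "z \<in> gauss \<Longrightarrow> - z \<in> gauss"
  and gauss_int_mult: "z \<in> gauss \<Longrightarrow> of_int n * z \<in> gauss"
  by (auto simp: gauss_def)

lemma cross_Ints: "z \<in> gauss \<Longrightarrow> w \<in> gauss \<Longrightarrow> cross z w \<in> \<int>"
  by (auto simp: gauss_def cross_eq)

lemma vtx_minus [simp]: "vtx (- z) = vtx z"
  by (simp add: vtx_def)

lemma norm_vtx: "z \<noteq> 0 \<Longrightarrow> cmod (vtx z) = 1"
  by (simp add: vtx_def norm_divide)

lemma vtx_diff:
  assumes "z \<noteq> 0" "w \<noteq> 0"
  shows "vtx z - vtx w = - (2 * \<i> * of_real (cross z w)) / (cnj z * cnj w)"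
proof -
  have "z * cnj w - w * cnj z = - (2 * \<i> * of_real (cross z w))"
    by (simp add: complex_eq_iff cross_eq)
  then show ?thesis
    using assms by (simp add: vtx_def diff_frac_eq mult.commute)
qed

lemma dist_vtx:
  assumes "z \<noteq> 0" "w \<noteq> 0"
  shows "dist (vtx z) (vtx w) = 2 * \<bar>cross z w\<bar> / (cmod z * cmod w)"
  using assms by (simp add: dist_norm vtx_diff norm_divide norm_mult)

text \<open>With \<open>vtx z\<close> at infinity, the other points are read off as an inner product
  over a determinant. Along \<open>w - n z\<close> the determinant is constant and the inner product
  is affine in \<open>n\<close>, which makes fans equally spaced and decides their
  direction.\<close>

lemma cayley_vtx:
  assumes "cross z w \<noteq> 0"
  shows "cayley (vtx z) (vtx w) = of_real (- Re (cnj z * w) / cross z w)"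
proof -
  have nz: "z \<noteq> 0" "w \<noteq> 0" using assms by (auto simp: cross_def)
  have s: "vtx z + vtx w = 2 * of_real (Re (cnj z * w)) / (cnj z * cnj w)"
  proof -
    have "z * cnj w + w * cnj z = 2 * of_real (Re (cnj z * w))"
      by (simp add: complex_eq_iff)
    then show ?thesis using nz by (simp add: vtx_def add_frac_eq mult.commute)
  qed
  show ?thesis
    using nz assms unfolding cayley_def s vtx_diff[OF nz] by (simp add: field_simps)
qed

text \<open>The reflection is induced by the real linear map that fixes \<open>z\<close> and negates
  \<open>w\<close>; it has determinant -1 and sends \<open>z + w\<close> to
  \<open>z - w\<close>.\<close>

lemma hyp_reflection_vtx:
  assumes "cross z w \<noteq> 0"
  shows "hyp_reflection (vtx z) (vtx w) (vtx z) = vtx z"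
    and "hyp_reflection (vtx z) (vtx w) (vtx w) = vtx w"
    and "hyp_reflection (vtx z) (vtx w) (vtx (z + w)) = vtx (z - w)"
proof -
  have nz: "z \<noteq> 0" "w \<noteq> 0" "z + w \<noteq> 0" "z - w \<noteq> 0"
    using assms by (auto simp: cross_eq add_eq_0_iff2)
  have ne: "vtx z \<noteq> vtx w" using vtx_diff[OF nz(1,2)] nz assms by auto
  note r = hyp_reflection_on_circle[OF norm_vtx[OF nz(1)] norm_vtx[OF nz(2)] ne]
  show "hyp_reflection (vtx z) (vtx w) (vtx z) = vtx z"
    using ne nz by (subst r) (simp_all add: norm_vtx field_simps)
  show "hyp_reflection (vtx z) (vtx w) (vtx w) = vtx w"
    using ne nz by (subst r) (simp_all add: norm_vtx field_simps)
  \<comment> \<open>Treating the conjugates as independent unknowns turns the claim into an identity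
    of rational functions.\<close>
  define Z W where "Z = cnj z" and "W = cnj w"
  have Z: "Z \<noteq> 0" "W \<noteq> 0" "Z + W \<noteq> 0" "Z - W \<noteq> 0"
    unfolding Z_def W_def using nz by (metis complex_cnj_zero_iff complex_cnj_add complex_cnj_diff)+
  have d: "z * W - w * Z \<noteq> 0"
    using assms unfolding Z_def W_def by (auto simp: complex_eq_iff cross_eq)
  have v: "vtx z = z / Z" "vtx w = w / W" "vtx (z + w) = (z + w) / (Z + W)"
    "vtx (z - w) = (z - w) / (Z - W)" by (simp_all add: vtx_def Z_def W_def)
  have num: "2 * (z / Z) * (w / W) - (z / Z + w / W) * ((z + w) / (Z + W))
      = (z - w) * (w * Z - z * W) / (Z * W * (Z + W))"
    using Z by (simp add: divide_simps) (simp add: algebra_simps)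
  have den: "z / Z + w / W - 2 * ((z + w) / (Z + W)) = (Z - W) * (w * Z - z * W) / (Z * W * (Z + W))"
    using Z by (simp add: divide_simps) (simp add: algebra_simps)
  show "hyp_reflection (vtx z) (vtx w) (vtx (z + w)) = vtx (z - w)"
    unfolding r[OF norm_vtx[OF nz(3)]] unfolding v mult.assoc[symmetric] num den
    using Z d by simp
qed

lemma hyp_reflection_commute: "hyp_reflection a b = hyp_reflection b a"
proof (cases "a + b = 0")
  case True
  then have "a = - b" by (simp add: add_eq_0_iff2)
  then show ?thesis by (simp add: hyp_reflection_def fun_eq_iff)
next
  case False
  then show ?thesis by (simp add: hyp_reflection_def fun_eq_iff add.commute mult.commute mult.left_commute)
qed

section \<open>Unimodular pairs and the moves between them\<close>

definition unimod :: "complex \<Rightarrow> complex \<Rightarrow> bool" where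
  "unimod z w \<longleftrightarrow> z \<in> gauss \<and> w \<in> gauss \<and> cross z w = 1"

lemma unimod_neq_0:
  assumes "unimod z w"
  shows "z \<noteq> 0" "w \<noteq> 0" "z + w \<noteq> 0" "z - w \<noteq> 0"
  using assms by (auto simp: unimod_def cross_eq add_eq_0_iff2)

text \<open>A basis stands for an oriented edge together with the triangle on one side of it, and
  \<open>vtx\<close> ignores signs. \<open>unimod_cyclic\<close> passes to the next edge of that
  triangle; \<open>unimod_reflect\<close> and \<open>unimod_rot\<close> reverse the edge and thereby
  pass to the triangle on its other side.\<close>

lemma unimod_cyclic: "unimod z w \<Longrightarrow> unimod w (- (z + w))"
  and unimod_reflect: "unimod z w \<Longrightarrow> unimod (- w) z"
  and unimod_rot: "unimod z w \<Longrightarrow> unimod w (- z)"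
  and unimod_minus: "unimod z w \<Longrightarrow> unimod (- z) (- w)"
  and unimod_add: "unimod z w \<Longrightarrow> unimod z (w + of_int n * z)"
  by (auto simp: unimod_def gauss_add gauss_minus gauss_int_mult gauss_diff cross_eq algebra_simps
      intro!: gauss_add gauss_int_mult[of _ n, unfolded mult.commute[of "of_int n"]])

text \<open>Cramer's rule in the basis \<open>z, w\<close>: since the determinant is 1, the
  coefficients of \<open>z'\<close> are integers, and the one of \<open>w\<close> is
  \<open>cross z z'\<close>.\<close>

lemma unimod_coprime_multiple:
  assumes "unimod z w" "z' \<in> gauss" "cross z z' = 0"
  obtains m :: int where "z' = of_int m * z"
proof -
  obtain m where m: "cross z' w = of_int m"
    using cross_Ints assms unfolding unimod_def by (metis Ints_cases)
  have "of_real (cross z w) * z' = of_real (cross z' w) * z + of_real (cross z z') * w"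
    by (simp add: complex_eq_iff cross_eq algebra_simps)
  with assms m have "z' = of_int m * z" by (simp add: unimod_def)
  then show ?thesis using that by blast
qed

lemma unimod_unique:
  assumes "unimod z w" "unimod z w'"
  obtains m :: int where "w' = w + of_int m * z"
proof -
  have "w' - w \<in> gauss" "cross z (w' - w) = 0"
    using assms by (auto simp: unimod_def gauss_diff cross_eq algebra_simps)
  then obtain m where "w' - w = of_int m * z" using unimod_coprime_multiple assms by metis
  then have "w' = w + of_int m * z" by (simp add: algebra_simps)
  then show ?thesis using that by blast
qed

text \<open>Equal vertices come from parallel vectors. Each is an integer multiple of the other, as
  both extend to a basis, so the factor is a unit.\<close>

lemma vtx_eq_imp:
  assumes "unimod z w" "unimod z' w'" "vtx z = vtx z'"
  shows "z' = z \<or> z' = - z"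
proof -
  have c: "cross z z' = 0" "cross z' z = 0"
    using dist_vtx[of z z'] assms unimod_neq_0(1)[OF assms(1)] unimod_neq_0(1)[OF assms(2)]
    by (auto simp: cross_eq mult.commute)
  obtain m where m: "z' = of_int m * z"
    using unimod_coprime_multiple[OF assms(1) _ c(1)] assms(2) unfolding unimod_def by blast
  obtain k where k: "z = of_int k * z'"
    using unimod_coprime_multiple[OF assms(2) _ c(2)] assms(1) unfolding unimod_def by blast
  have "z = of_int (k * m) * z" using k m by (metis mult.assoc of_int_mult)
  then have "of_int (k * m) = (1::complex)" using unimod_neq_0[OF assms(1)] by simp
  then have "k * m = 1" by (simp only: of_int_eq_1_iff)
  then have "m = 1 \<or> m = -1" by (auto simp: zmult_eq_1_iff)
  with m show ?thesis by auto
qed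

text \<open>Membership in \<open>farey_triangles\<close> travels with the basis. All moves below
  preserve both, which spares a descent showing that every unimodular pair is reached; for the
  summation an upper bound on the set of edges is enough.\<close>

definition farey_pair :: "complex \<Rightarrow> complex \<Rightarrow> bool" where
  "farey_pair z w \<longleftrightarrow> unimod z w \<and> {vtx z, vtx w, vtx (z + w)} \<in> farey_triangles"

lemma farey_pair_cyclic: "farey_pair z w \<Longrightarrow> farey_pair w (- (z + w))"
proof -
  assume a: "farey_pair z w"
  have "{vtx w, vtx (- (z + w)), vtx (w + - (z + w))} = {vtx z, vtx w, vtx (z + w)}"
    using vtx_minus[of z] vtx_minus[of "z + w"] by (auto simp del: vtx_minus simp: add.commute)
  with a show ?thesis using unimod_cyclic unfolding farey_pair_def by metis
qed

lemma farey_pair_minus: "farey_pair z w \<Longrightarrow> farey_pair (- z) (- w)"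
  using unimod_minus vtx_minus[of "z + w"] unfolding farey_pair_def by (simp add: add.commute)

lemma vtx_neq: "cross z w \<noteq> 0 \<Longrightarrow> vtx z \<noteq> vtx w"
  using dist_vtx[of z w] by (cases "z = 0 \<or> w = 0") (auto simp: cross_def)

lemma reflect_triangle:
  assumes "unimod z w"
  shows "hyp_reflection (vtx z) (vtx w) ` {vtx z, vtx w, vtx (z + w)} = {vtx (-w), vtx z, vtx (-w + z)}"
  using assms hyp_reflection_vtx[of z w] by (auto simp: unimod_def)

lemma farey_pair_reflect:
  assumes "farey_pair z w" shows "farey_pair (- w) z"
proof -
  have "vtx z \<noteq> vtx w" using assms by (intro vtx_neq) (auto simp: farey_pair_def unimod_def)
  then have "hyp_reflection (vtx z) (vtx w) ` {vtx z, vtx w, vtx (z + w)} \<in> farey_triangles"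
    using assms by (intro farey_triangles.reflect) (auto simp: farey_pair_def)
  then show ?thesis
    using assms reflect_triangle[of z w] unimod_reflect by (simp add: farey_pair_def)
qed

lemma farey_pair_rot: "farey_pair z w \<Longrightarrow> farey_pair w (- z)"
  using farey_pair_minus[OF farey_pair_reflect, of z w] by simp

text \<open>One step around \<open>vtx z\<close>: turn the triangle to its edge between
  \<open>vtx (z + w)\<close> and \<open>vtx z\<close>, then cross that edge.\<close>

lemma farey_pair_add_1: "farey_pair z w \<Longrightarrow> farey_pair z (w + z)"
  using farey_pair_cyclic[of z w] farey_pair_cyclic[of w "- (z + w)"] farey_pair_reflect[of "- (z + w)" z]
    farey_pair_minus[of "-z" "-(z+w)"] by (simp add: add.commute)

lemma farey_pair_diff_1: "farey_pair z w \<Longrightarrow> farey_pair z (w - z)"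
  using farey_pair_reflect[of z w] farey_pair_cyclic[of "-w" z] by simp

lemma farey_pair_shift: "farey_pair z w \<Longrightarrow> farey_pair z (w + of_int n * z)"
proof (induction n rule: int_induct[where k = 0])
  case base then show ?case by simp
next
  case (step1 i)
  then show ?case using farey_pair_add_1[of z "w + of_int i * z"] by (simp add: algebra_simps)
next
  case (step2 i)
  then show ?case using farey_pair_diff_1[of z "w + of_int i * z"] by (simp add: algebra_simps)
qed

lemma farey_triangle_pair:
  assumes "T = {vtx z, vtx w, vtx (z + w)}" "unimod z w" "a \<in> T" "b \<in> T" "a \<noteq> b"
  obtains z' w' where "unimod z' w'" "{a, b} = {vtx z', vtx w'}" "T = {vtx z', vtx w', vtx (z' + w')}"
proof -
  have u: "unimod w (- (z + w))" "unimod (- (z + w)) z"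
    using unimod_cyclic[OF assms(2)] unimod_cyclic[of w "- (z + w)"] by auto
  have v: "vtx (- (z + w)) = vtx (z + w)" "vtx (w + - (z + w)) = vtx z" "vtx (- (z + w) + z) = vtx w"
    using vtx_minus[of "z + w"] vtx_minus[of z] vtx_minus[of w] by (simp_all del: vtx_minus)
  from assms(1,3,4,5) consider "{a,b} = {vtx z, vtx w}" | "{a,b} = {vtx w, vtx (z + w)}"
    | "{a,b} = {vtx (z + w), vtx z}" by blast
  then show ?thesis
  proof cases
    case 1 then show ?thesis using that assms by blast
  next
    case 2 show ?thesis by (rule that[OF u(1)]) (use assms(1) 2 v in auto)
  next
    case 3 show ?thesis by (rule that[OF u(2)]) (use assms(1) 3 v in auto)
  qed
qed

lemma farey_triangle_unimod:
  assumes "T \<in> farey_triangles"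
  shows "\<exists>z w. unimod z w \<and> T = {vtx z, vtx w, vtx (z + w)}"
  using assms
proof (induction rule: farey_triangles.induct)
  case base
  have "unimod 1 \<i>" by (simp add: unimod_def gauss_def cross_eq)
  moreover have "vtx 1 = 1" "vtx \<i> = -1" "vtx (1 + \<i>) = \<i>"
    by (simp_all add: vtx_def complex_eq_iff Re_divide Im_divide)
  ultimately show ?case by (intro exI[of _ 1] exI[of _ \<i>]) auto
next
  case (reflect T a b)
  from reflect.IH obtain z0 w0 where "unimod z0 w0" "T = {vtx z0, vtx w0, vtx (z0 + w0)}" by blast
  with reflect.hyps obtain z w where zw: "unimod z w" "{a, b} = {vtx z, vtx w}"
    "T = {vtx z, vtx w, vtx (z + w)}" using farey_triangle_pair by metis
  have "hyp_reflection a b = hyp_reflection (vtx z) (vtx w)"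
    using zw(2) hyp_reflection_commute by (auto simp: doubleton_eq_iff)
  then show ?case using reflect_triangle[OF zw(1)] unimod_reflect[OF zw(1)] zw(3) by metis
qed

lemma farey_triangle_farey_pair:
  assumes "T \<in> farey_triangles" "a \<in> T" "b \<in> T" "a \<noteq> b"
  obtains z w where "farey_pair z w" "{a, b} = {vtx z, vtx w}" "T = {vtx z, vtx w, vtx (z + w)}"
  using farey_triangle_unimod[OF assms(1)] farey_triangle_pair assms unfolding farey_pair_def by metis

lemma farey_edge_iff: "e \<in> farey_edges \<longleftrightarrow> (\<exists>z w. farey_pair z w \<and> e = {vtx z, vtx w})"
proof
  assume "e \<in> farey_edges"
  then obtain a b T where "e = {a, b}" "a \<noteq> b" "T \<in> farey_triangles" "a \<in> T" "b \<in> T"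
    unfolding farey_edges_def by blast
  then show "\<exists>z w. farey_pair z w \<and> e = {vtx z, vtx w}"
    by (metis farey_triangle_farey_pair)
next
  assume "\<exists>z w. farey_pair z w \<and> e = {vtx z, vtx w}"
  then obtain z w where zw: "farey_pair z w" "e = {vtx z, vtx w}" by blast
  then have "vtx z \<noteq> vtx w" by (intro vtx_neq) (auto simp: farey_pair_def unimod_def)
  with zw show "e \<in> farey_edges" unfolding farey_edges_def farey_pair_def by blast
qed

lemma farey_edge_through:
  assumes "{v, y} \<in> farey_edges"
  obtains z w where "farey_pair z w" "v = vtx z" "y = vtx w"
proof -
  obtain z w where zw: "farey_pair z w" "{v, y} = {vtx z, vtx w}"
    using assms farey_edge_iff by blast
  show ?thesis
  proof (cases "v = vtx z")
    case True then show ?thesis using that zw by (metis doubleton_eq_iff)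
  next
    case False
    then have "v = vtx w" "y = vtx z" using zw(2) by (auto simp: doubleton_eq_iff)
    then show ?thesis using that[of w "- z"] farey_pair_rot[OF zw(1)] by simp
  qed
qed

lemma farey_vertex_pair:
  assumes "v \<in> farey_vertices"
  obtains z w where "farey_pair z w" "v = vtx z"
proof -
  obtain T where T: "T \<in> farey_triangles" "v \<in> T" using assms by (auto simp: farey_vertices_def)
  then obtain z w where zw: "unimod z w" "T = {vtx z, vtx w, vtx (z + w)}"
    using farey_triangle_unimod by blast
  have "vtx z \<noteq> vtx w" using zw by (intro vtx_neq) (auto simp: unimod_def)
  then obtain y where "y \<in> T" "y \<noteq> v" using zw by blast
  then have "{v, y} \<in> farey_edges" using T unfolding farey_edges_def by blast
  then show ?thesis using farey_edge_through that by metis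
qed

section \<open>Fans as arithmetic progressions\<close>

lemma fan_vtx:
  assumes "farey_pair z w"
  shows "fan (vtx z) = range (\<lambda>n::int. {vtx z, vtx (w - of_int n * z)})"
proof (intro equalityI subsetI)
  fix e assume "e \<in> fan (vtx z)"
  then have e: "e \<in> farey_edges" "vtx z \<in> e" by (auto simp: fan_def)
  then obtain z1 w1 where "e = {vtx z1, vtx w1}" unfolding farey_edge_iff by blast
  with e(2) obtain y where y: "e = {vtx z, y}" by (metis insertE insert_commute singletonD)
  with e obtain z' w' where p: "farey_pair z' w'" "vtx z = vtx z'" "y = vtx w'"
    using farey_edge_through by metis
  have u: "unimod z w" "unimod z' w'" using assms p by (auto simp: farey_pair_def)
  \<comment> \<open>If \<open>z' = - z\<close>, negating both vectors restores \<open>z\<close> in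
    the first place without moving a vertex.\<close>
  have "\<exists>w''. unimod z w'' \<and> vtx w'' = vtx w'"
    using vtx_eq_imp[OF u p(2)] u(2) unimod_minus[OF u(2)] by (metis vtx_minus add.inverse_inverse)
  then obtain w'' where w'': "unimod z w''" "vtx w'' = vtx w'" by blast
  \<comment> \<open>The second vectors of all bases starting with \<open>z\<close> form one coset of
    the multiples of \<open>z\<close>. The indexing subtracts multiples so that it runs from left to
    right.\<close>
  obtain m where "w'' = w + of_int m * z" using unimod_unique[OF u(1) w''(1)] .
  then have "w'' = w - of_int (- m) * z" by simp
  then have "e = (\<lambda>n::int. {vtx z, vtx (w - of_int n * z)}) (- m)" using y p(3) w''(2) by simp
  then show "e \<in> range (\<lambda>n::int. {vtx z, vtx (w - of_int n * z)})" by (rule range_eqI)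
next
  fix e assume "e \<in> range (\<lambda>n::int. {vtx z, vtx (w - of_int n * z)})"
  then obtain n :: int where n: "e = {vtx z, vtx (w - of_int n * z)}" by blast
  have "farey_pair z (w - of_int n * z)" using farey_pair_shift[OF assms, of "- n"] by simp
  then show "e \<in> fan (vtx z)" unfolding fan_def using n farey_edge_iff by blast
qed

lemma cross_shift: "cross z (w - of_int n * z) = cross z w"
  by (simp add: cross_eq algebra_simps)

lemma cayley_fan:
  assumes "unimod z w"
  shows "cayley (vtx z) (vtx (w - of_int n * z)) = of_real (- Re (cnj z * w) + of_int n * (cmod z)\<^sup>2)"
proof -
  have c: "cross z (w - of_int n * z) = 1" using assms cross_shift by (simp add: unimod_def)
  have "Re (cnj z * (w - of_int n * z)) = Re (cnj z * w) - of_int n * (cmod z)\<^sup>2"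
    unfolding cmod_power2 by (simp add: algebra_simps power2_eq_square)
  with c cayley_vtx[of z "w - of_int n * z"] show ?thesis by (simp only: c div_by_1 minus_diff_eq) simp
qed

lemma fan_indexing_vtx:
  assumes "farey_pair z w"
  shows "fan_indexing (vtx z) (\<lambda>n. {vtx z, vtx (w - of_int n * z)})"
proof -
  have u: "unimod z w" using assms by (simp add: farey_pair_def)
  have ne: "vtx (w - of_int n * z) \<noteq> vtx z" for n :: int
    using vtx_neq[of z "w - of_int n * z"] cross_shift u by (auto simp: unimod_def)
  have pos: "(cmod z)\<^sup>2 > 0" using unimod_neq_0[OF u] by simp
  have "inj (\<lambda>n::int. {vtx z, vtx (w - of_int n * z)})"
  proof
    fix m n :: int assume "{vtx z, vtx (w - of_int m * z)} = {vtx z, vtx (w - of_int n * z)}"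
    then have "vtx (w - of_int m * z) = vtx (w - of_int n * z)" using ne by (metis doubleton_eq_iff)
    then have "cayley (vtx z) (vtx (w - of_int m * z)) = cayley (vtx z) (vtx (w - of_int n * z))" by simp
    then show "m = n" unfolding cayley_fan[OF u] of_real_eq_iff using pos by auto
  qed
  then have "bij_betw (\<lambda>n::int. {vtx z, vtx (w - of_int n * z)}) UNIV (fan (vtx z))"
    using fan_vtx[OF assms] by (simp add: bij_betw_def)
  moreover have "\<forall>n. \<exists>y. y \<noteq> vtx z \<and> {vtx z, vtx (w - of_int n * z)} = {vtx z, y} \<and>
     cayley (vtx z) y = of_real (- Re (cnj z * w) + of_int n * (cmod z)\<^sup>2)"
    using ne cayley_fan[OF u] by blast
  ultimately show ?thesis unfolding fan_indexing_def using pos by blast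
qed

text \<open>A gap is the difference of two members of the other progression, hence an integer
  multiple of the other gap. By symmetry the factor is a unit, and positivity leaves 1.\<close>

lemma arith_progression_unique:
  fixes x x' \<delta> \<delta>' :: real
  assumes "\<delta> > 0" "\<delta>' > 0"
    and "range (\<lambda>n::int. x + of_int n * \<delta>) = range (\<lambda>n::int. x' + of_int n * \<delta>')"
  obtains m :: int where "\<delta> = \<delta>'" "x = x' - of_int m * \<delta>'"
proof -
  have A: "\<exists>j::int. a + of_int i * c = b + of_int j * d"
    if "range (\<lambda>n::int. a + of_int n * c) = range (\<lambda>n::int. b + of_int n * d)" for a b c d :: real and i :: int
  proof -
    have "a + of_int i * c \<in> range (\<lambda>n::int. b + of_int n * d)" unfolding that[symmetric] by blast
    then show ?thesis by blast
  qed
  have B: "\<exists>j::int. c = of_int j * d"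
    if r: "range (\<lambda>n::int. a + of_int n * c) = range (\<lambda>n::int. b + of_int n * d)" for a b c d :: real
  proof -
    obtain i :: int where "a = b + of_int i * d" using A[OF r, of 0] by auto
    moreover obtain j :: int where "a + c = b + of_int j * d" using A[OF r, of 1] by auto
    ultimately have "c = of_int (j - i) * d" by (simp add: algebra_simps)
    then show ?thesis by blast
  qed
  obtain j :: int where j: "\<delta> = of_int j * \<delta>'" using B[OF assms(3)] by blast
  obtain k :: int where k: "\<delta>' = of_int k * \<delta>" using B[OF assms(3)[symmetric]] by blast
  have "\<delta> = of_int (j * k) * \<delta>" using j k by (metis mult.assoc of_int_mult)
  then have "of_int (j * k) = (1::real)" using assms(1) by simp
  then have "j * k = 1" by (simp only: of_int_eq_1_iff)
  moreover have "j > 0"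
  proof -
    have "0 < of_int j * \<delta>'" using j assms(1) by simp
    then show ?thesis using assms(2) by (simp add: zero_less_mult_iff)
  qed
  ultimately have "j = 1" by (auto simp: zmult_eq_1_iff)
  then have d: "\<delta> = \<delta>'" using j by simp
  obtain i :: int where "x = x' + of_int i * \<delta>'" using A[OF assms(3), of 0] by auto
  then show ?thesis using d that[of "- i"] by simp
qed

text \<open>\<open>fan_edge\<close> comes from a choice operator, so it can be compared with the
  explicit indexing only up to a shift; the equal spacing leaves no other freedom.\<close>

lemma fan_edge_vtx:
  assumes "farey_pair z w"
  obtains m :: int where "\<And>n. fan_edge (vtx z) n = {vtx z, vtx (w - of_int (n - m) * z)}"
proof -
  define g where "g = (\<lambda>n::int. {vtx z, vtx (w - of_int n * z)})"
  have u: "unimod z w" using assms by (simp add: farey_pair_def)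
  have ne: "vtx (w - of_int n * z) \<noteq> vtx z" for n :: int
    using vtx_neq[of z "w - of_int n * z"] cross_shift u by (auto simp: unimod_def)
  have "fan_indexing (vtx z) (fan_edge (vtx z))"
    unfolding fan_edge_def using fan_indexing_vtx[OF assms] by (rule someI[where P = "fan_indexing (vtx z)"])
  then obtain x \<delta> where f: "bij_betw (fan_edge (vtx z)) UNIV (fan (vtx z))" "\<delta> > 0"
    and "\<forall>n. \<exists>y. y \<noteq> vtx z \<and> fan_edge (vtx z) n = {vtx z, y} \<and> cayley (vtx z) y = of_real (x + of_int n * \<delta>)"
    unfolding fan_indexing_def by blast
  then obtain y where y: "\<And>n. y n \<noteq> vtx z" "\<And>n. fan_edge (vtx z) n = {vtx z, y n}"
    "\<And>n. cayley (vtx z) (y n) = of_real (x + of_int n * \<delta>)" by metis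
  have range_eq: "range (fan_edge (vtx z)) = range g"
    using f(1) fan_vtx[OF assms] by (simp add: bij_betw_def g_def)
  define x' where "x' = - Re (cnj z * w)"
  have c: "cayley (vtx z) (vtx (w - of_int n * z)) = of_real (x' + of_int n * (cmod z)\<^sup>2)" for n
    using cayley_fan[OF u] by (simp add: x'_def)
  have match: "x + of_int n * \<delta> = x' + of_int k * (cmod z)\<^sup>2 \<and> y n = vtx (w - of_int k * z)"
    if "fan_edge (vtx z) n = g k" for n k
  proof -
    have "y n = vtx (w - of_int k * z)" using that y(1,2) ne unfolding g_def by (metis doubleton_eq_iff)
    then show ?thesis using y(3)[of n] c[of k] by (metis of_real_eq_iff)
  qed
  have prog: "range (\<lambda>n::int. x + of_int n * \<delta>) = range (\<lambda>n::int. x' + of_int n * (cmod z)\<^sup>2)"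
  proof (intro equalityI subsetI)
    fix t assume "t \<in> range (\<lambda>n::int. x + of_int n * \<delta>)"
    then obtain n :: int where n: "t = x + of_int n * \<delta>" by blast
    obtain k where "fan_edge (vtx z) n = g k" using range_eq by (metis rangeE rangeI)
    then have "t = x' + of_int k * (cmod z)\<^sup>2" using match n by simp
    then show "t \<in> range (\<lambda>n::int. x' + of_int n * (cmod z)\<^sup>2)" by (rule range_eqI)
  next
    fix t assume "t \<in> range (\<lambda>n::int. x' + of_int n * (cmod z)\<^sup>2)"
    then obtain k :: int where k: "t = x' + of_int k * (cmod z)\<^sup>2" by blast
    obtain n where "fan_edge (vtx z) n = g k" using range_eq by (metis rangeE rangeI)
    then have "t = x + of_int n * \<delta>" using match k by simp
    then show "t \<in> range (\<lambda>n::int. x + of_int n * \<delta>)" by (rule range_eqI)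
  qed
  have pos: "(cmod z)\<^sup>2 > 0" using unimod_neq_0[OF u] by simp
  obtain m where m: "\<delta> = (cmod z)\<^sup>2" "x = x' - of_int m * (cmod z)\<^sup>2"
    using arith_progression_unique[OF f(2) pos prog] .
  have "fan_edge (vtx z) n = {vtx z, vtx (w - of_int (n - m) * z)}" for n
  proof -
    obtain k where k: "fan_edge (vtx z) n = g k" using range_eq by (metis rangeE rangeI)
    have "of_int (n - m) * (cmod z)\<^sup>2 = of_int k * (cmod z)\<^sup>2"
      using match[OF k] m by (simp add: algebra_simps)
    then have "k = n - m" using pos by (simp del: of_int_diff)
    then show ?thesis using k by (simp add: g_def)
  qed
  then show ?thesis using that by blast
qed

lemma fan_pos_vtx:
  assumes "farey_pair z w" "\<And>n. fan_edge (vtx z) n = {vtx z, vtx (w - of_int (n - m) * z)}"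
  shows "fan_pos (vtx z) {vtx z, vtx (w - of_int k * z)} = m + k"
proof -
  have "inj (\<lambda>n::int. {vtx z, vtx (w - of_int n * z)})"
    using fan_indexing_vtx[OF assms(1)] by (simp add: fan_indexing_def bij_betw_def)
  then have "(fan_edge (vtx z) n = {vtx z, vtx (w - of_int k * z)}) \<longleftrightarrow> n - m = k" for n
    unfolding assms(2) by (rule inj_eq)
  then have "(fan_edge (vtx z) n = {vtx z, vtx (w - of_int k * z)}) \<longleftrightarrow> n = m + k" for n
    by (metis add.commute diff_add_cancel add_diff_cancel)
  then show ?thesis unfolding fan_pos_def by simp
qed

section \<open>Shears as cross-ratios of distances\<close>

lemma cis_add_cis:
  "cis s + cis t = 2 * of_real (cos ((t - s) / 2)) * cis ((s + t) / 2)"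
  and cis_diff_cis:
  "cis t - cis s = 2 * \<i> * of_real (sin ((t - s) / 2)) * cis ((s + t) / 2)"
proof -
  define m d where "m = (s + t) / 2" and "d = (t - s) / 2"
  have st: "s = m - d" "t = m + d" unfolding m_def d_def by (simp_all add: field_simps)
  show "cis s + cis t = 2 * of_real (cos ((t - s) / 2)) * cis ((s + t) / 2)"
    unfolding m_def[symmetric] d_def[symmetric] unfolding st
    by (simp add: complex_eq_iff cos_add cos_diff sin_add sin_diff)
  show "cis t - cis s = 2 * \<i> * of_real (sin ((t - s) / 2)) * cis ((s + t) / 2)"
    unfolding m_def[symmetric] d_def[symmetric] unfolding st
    by (simp add: complex_eq_iff cos_add cos_diff sin_add sin_diff)
qed

lemma dist_cis: "dist (cis s) (cis t) = 2 * \<bar>sin ((t - s) / 2)\<bar>"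
  by (subst dist_commute) (simp add: dist_norm cis_diff_cis norm_mult)

lemma cayley_cis:
  assumes "sin ((t - s) / 2) \<noteq> 0"
  shows "cayley (cis s) (cis t) = of_real (- cot ((t - s) / 2))"
proof -
  have e: "cis s - cis t = - (2 * \<i> * of_real (sin ((t - s) / 2)) * cis ((s + t) / 2))"
    unfolding cis_diff_cis[of t s, symmetric] by simp
  show ?thesis
    using assms unfolding cayley_def cis_add_cis[of s t] e
    by (simp add: cot_def field_simps)
qed

lemma cot_less_cot:
  assumes "0 < x" "x < y" "y < pi"
  shows "cot y < cot x"
proof -
  have s: "sin x > 0" "sin y > 0" "sin (y - x) > 0" using assms by (auto intro!: sin_gt_zero)
  have "cot x - cot y = sin (y - x) / (sin x * sin y)"
    using s by (simp add: cot_def sin_diff field_simps)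
  with s show ?thesis by (metis diff_gt_0_iff_gt divide_pos_pos mult_pos_pos)
qed

text \<open>Going counterclockwise from the point sent to infinity means moving right on the real
  line, because minus the cotangent of the half angle increases on (0, pi).\<close>

lemma cayley_less_iff:
  assumes "s < t" "t < s + 2 * pi" "s < t'" "t' < s + 2 * pi"
  shows "Re (cayley (cis s) (cis t)) < Re (cayley (cis s) (cis t')) \<longleftrightarrow> t < t'"
proof -
  have "sin ((t - s) / 2) > 0" "sin ((t' - s) / 2) > 0"
    using assms by (auto intro!: sin_gt_zero)
  then have "Re (cayley (cis s) (cis t)) < Re (cayley (cis s) (cis t')) \<longleftrightarrow>
      cot ((t' - s) / 2) < cot ((t - s) / 2)"
    by (simp add: cayley_cis)
  also have "\<dots> \<longleftrightarrow> t < t'"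
    using cot_less_cot[of "(t - s) / 2" "(t' - s) / 2"] cot_less_cot[of "(t' - s) / 2" "(t - s) / 2"] assms
    by (cases t t' rule: linorder_cases) auto
  finally show ?thesis .
qed

lemma circle_eq_cis:
  assumes "cmod w = 1"
  obtains t where "w = cis t"
proof -
  have "w \<noteq> 0" using assms by auto
  then have "w = cis (Arg w)" using assms by (simp add: cis_Arg sgn_div_norm)
  then show ?thesis using that by blast
qed

lemma circle_cis_interval:
  assumes "cmod w = 1" "w \<noteq> cis s"
  obtains t where "w = cis t" "s < t" "t < s + 2 * pi"
proof -
  define u where "u = w / cis s"
  have u: "cmod u = 1" "u \<noteq> 1" using assms by (auto simp: u_def norm_divide field_simps)
  define \<theta> where "\<theta> = Arg2pi u"
  have b: "0 \<le> \<theta>" "\<theta> < 2 * pi" using Arg2pi unfolding \<theta>_def by auto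
  have c: "u = cis \<theta>" using Arg2pi_eq[of u] u(1) unfolding \<theta>_def cis_conv_exp by auto
  have "\<theta> \<noteq> 0" using c u(2) by auto
  moreover have "w = cis (s + \<theta>)" using c unfolding u_def cis_mult[symmetric] by (simp add: field_simps)
  ultimately show ?thesis using that[of "s + \<theta>"] b by auto
qed

text \<open>Cyclic order becomes the order of real numbers, which for the points of a fan is visible
  from \<open>cayley_fan\<close>.\<close>

lemma ccw4_iff_cayley:
  assumes "cmod a = 1" "cmod b = 1" "cmod c = 1" "cmod d = 1" "b \<noteq> a" "c \<noteq> a" "d \<noteq> a"
  shows "ccw4 a b c d \<longleftrightarrow> Re (cayley a b) < Re (cayley a c) \<and> Re (cayley a c) < Re (cayley a d)"
proof
  assume "ccw4 a b c d"
  then show "Re (cayley a b) < Re (cayley a c) \<and> Re (cayley a c) < Re (cayley a d)"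
    unfolding ccw4_def using cayley_less_iff by auto
next
  assume l: "Re (cayley a b) < Re (cayley a c) \<and> Re (cayley a c) < Re (cayley a d)"
  obtain s where s: "a = cis s" using circle_eq_cis assms(1) .
  obtain t1 where t1: "b = cis t1" "s < t1" "t1 < s + 2 * pi" using circle_cis_interval assms s by metis
  obtain t2 where t2: "c = cis t2" "s < t2" "t2 < s + 2 * pi" using circle_cis_interval assms s by metis
  obtain t3 where t3: "d = cis t3" "s < t3" "t3 < s + 2 * pi" using circle_cis_interval assms s by metis
  have "t1 < t2" using l cayley_less_iff[of s t1 t2] s t1 t2 by simp
  moreover have "t2 < t3" using l cayley_less_iff[of s t2 t3] s t3 t2 by simp
  ultimately show "ccw4 a b c d" unfolding ccw4_def using s t1 t2 t3 by blast
qed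

lemma ccw4_distinct:
  assumes "ccw4 a b c d"
  shows "distinct [a, b, c, d]"
proof -
  have ne: "cis s \<noteq> cis t" if "s < t" "t < s + 2 * pi" for s t
  proof -
    have "sin ((t - s) / 2) > 0" using that by (intro sin_gt_zero) auto
    then show ?thesis using dist_cis[of s t] by auto
  qed
  obtain t1 t2 t3 t4 where t: "t1 < t2" "t2 < t3" "t3 < t4" "t4 < t1 + 2 * pi"
    "a = cis t1" "b = cis t2" "c = cis t3" "d = cis t4" using assms unfolding ccw4_def by blast
  show ?thesis using ne[of t1 t2] ne[of t1 t3] ne[of t1 t4] ne[of t2 t3] ne[of t2 t4] ne[of t3 t4] t by simp
qed

lemma ccw4_norm:
  assumes "ccw4 a b c d" shows "cmod a = 1" "cmod b = 1" "cmod c = 1" "cmod d = 1"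
  using assms unfolding ccw4_def by auto

lemma cr_ccw4:
  assumes "ccw4 a b c d"
  shows "Re (cr a b c d) = (dist a b * dist c d) / (dist b c * dist a d)"
proof -
  obtain t1 t2 t3 t4 where t: "t1 < t2" "t2 < t3" "t3 < t4" "t4 < t1 + 2 * pi"
    and [simp]: "a = cis t1" "b = cis t2" "c = cis t3" "d = cis t4" using assms unfolding ccw4_def by blast
  have s: "sin ((t2 - t1) / 2) > 0" "sin ((t4 - t3) / 2) > 0" "sin ((t3 - t2) / 2) > 0" "sin ((t4 - t1) / 2) > 0"
    using t by (auto intro!: sin_gt_zero)
  \<comment> \<open>The phases of the four chords cancel: numerator and denominator both carry half
    the sum of the four angles.\<close>
  have "cis ((t1 + t2) / 2) * cis ((t3 + t4) / 2) = cis ((t2 + t3) / 2) * cis ((t1 + t4) / 2)"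
    by (simp add: cis_mult field_simps)
  then have "cr a b c d = of_real ((sin ((t2 - t1) / 2) * sin ((t4 - t3) / 2)) / (sin ((t3 - t2) / 2) * sin ((t4 - t1) / 2)))"
    using s unfolding cr_def by (simp add: cis_diff_cis divide_simps)
  then have "Re (cr a b c d) = (sin ((t2 - t1) / 2) * sin ((t4 - t3) / 2)) / (sin ((t3 - t2) / 2) * sin ((t4 - t1) / 2))"
    by (simp)
  then show ?thesis using s by (simp add: dist_cis)
qed

section \<open>The quadrilateral around an edge\<close>

lemma farey_quad_vtx:
  assumes "farey_pair z w"
  shows "farey_quad (vtx z) (vtx (w + z)) (vtx w) (vtx (w - z))"
proof -
  have u: "unimod z w" using assms by (simp add: farey_pair_def)
  note nz = unimod_neq_0[OF u]
  have ne: "vtx (w - of_int n * z) \<noteq> vtx z" for n :: int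
    using vtx_neq[of z "w - of_int n * z"] cross_shift u by (auto simp: unimod_def)
  have pos: "(cmod z)\<^sup>2 > 0" using nz by simp
  \<comment> \<open>Seen from \<open>vtx z\<close>, the other three vertices are the fan points of
    index -1, 0 and 1.\<close>
  have "ccw4 (vtx z) (vtx (w + z)) (vtx w) (vtx (w - z))"
    using nz norm_vtx[of z] norm_vtx[of w] norm_vtx[of "w + z"] norm_vtx[of "w - z"]
      ne[of "-1"] ne[of 0] ne[of 1] cayley_fan[OF u, of "-1"] cayley_fan[OF u, of 0] cayley_fan[OF u, of 1] pos
    by (subst ccw4_iff_cayley) (auto simp: add.commute)
  moreover have "{vtx z, vtx (w + z), vtx w} \<in> farey_triangles"
    using assms by (simp add: farey_pair_def add.commute insert_commute)
  moreover have "{vtx z, vtx w, vtx (w - z)} \<in> farey_triangles"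
    using farey_pair_diff_1[OF assms] by (simp add: farey_pair_def insert_commute)
  ultimately show ?thesis by (simp add: farey_quad_def)
qed

text \<open>By \<open>vtx_eq_imp\<close> the edge determines its basis up to order and signs, so the
  third vertex can only come from the sum or the difference.\<close>

lemma farey_triangle_third:
  assumes "unimod z w" "{vtx z, vtx w, b} \<in> farey_triangles" "b \<noteq> vtx z" "b \<noteq> vtx w"
  shows "b = vtx (w + z) \<or> b = vtx (w - z)"
proof -
  have ne: "vtx z \<noteq> vtx w" using assms(1) by (intro vtx_neq) (auto simp: unimod_def)
  obtain z' w' where p: "farey_pair z' w'" "{vtx z, vtx w} = {vtx z', vtx w'}"
    "{vtx z, vtx w, b} = {vtx z', vtx w', vtx (z' + w')}"
    using farey_triangle_farey_pair[OF assms(2) _ _ ne] by blast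
  have u: "unimod z' w'" "unimod w (- z)" "unimod w' (- z')"
    using p(1) assms(1) unimod_rot by (auto simp: farey_pair_def)
  have b: "b = vtx (z' + w')" using p(2,3) assms(3,4) by blast
  have "(z' = z \<or> z' = - z) \<and> (w' = w \<or> w' = - w) \<or> (w' = z \<or> w' = - z) \<and> (z' = w \<or> z' = - w)"
    using p(2) vtx_eq_imp[OF assms(1) u(1)] vtx_eq_imp[OF assms(1) u(3)]
       vtx_eq_imp[OF u(2) u(1)] vtx_eq_imp[OF u(2) u(3)] by (auto simp: doubleton_eq_iff)
  moreover have "vtx (- w - z) = vtx (w + z)" "vtx (z - w) = vtx (w - z)"
    using vtx_minus[of "w + z"] vtx_minus[of "w - z"] by (simp_all del: vtx_minus)
  ultimately show ?thesis unfolding b by (auto simp: add.commute)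
qed

text \<open>Each of \<open>b\<close> and \<open>d\<close> has two candidates. The point
  \<open>vtx (w - z)\<close> lies to the right of \<open>vtx w\<close> when \<open>vtx z\<close> is
  at infinity, so it is not \<open>b\<close>; distinctness then settles \<open>d\<close>.\<close>

lemma farey_quad_vtx_unique:
  assumes "farey_pair z w" "farey_quad (vtx z) b (vtx w) d"
  shows "b = vtx (w + z) \<and> d = vtx (w - z)"
proof -
  have u: "unimod z w" using assms by (simp add: farey_pair_def)
  have q: "ccw4 (vtx z) b (vtx w) d" "{vtx z, vtx w, b} \<in> farey_triangles" "{vtx z, vtx w, d} \<in> farey_triangles"
    using assms(2) by (auto simp: farey_quad_def insert_commute)
  have q': "ccw4 (vtx z) (vtx (w + z)) (vtx w) (vtx (w - z))"
    using farey_quad_vtx[OF assms(1)] by (simp add: farey_quad_def)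
  have d: "b \<noteq> vtx z" "b \<noteq> vtx w" "d \<noteq> vtx z" "d \<noteq> vtx w" "b \<noteq> d" "vtx z \<noteq> vtx w"
     "vtx (w + z) \<noteq> vtx z" "vtx (w - z) \<noteq> vtx z"
    using ccw4_distinct[OF q(1)] ccw4_distinct[OF q'] by auto
  have "Re (cayley (vtx z) b) < Re (cayley (vtx z) (vtx w))"
    using q(1) ccw4_iff_cayley[OF ccw4_norm[OF q(1)]] d by auto
  moreover have "Re (cayley (vtx z) (vtx w)) < Re (cayley (vtx z) (vtx (w - z)))"
    using q' ccw4_iff_cayley[OF ccw4_norm[OF q']] d by auto
  ultimately have "b \<noteq> vtx (w - z)" by auto
  then show ?thesis
    using farey_triangle_third[OF u q(2) d(1,2)] farey_triangle_third[OF u q(3) d(3,4)] d(5) by auto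
qed

lemma shear_vtx:
  assumes "farey_pair z w"
  shows "shear h {vtx z, vtx w} = ln (Re (cr (h (vtx z)) (h (vtx (w + z))) (h (vtx w)) (h (vtx (w - z)))))"
  unfolding shear_def
proof (rule the_equality)
  show "\<exists>a b c d. farey_quad a b c d \<and> {vtx z, vtx w} = {a, c} \<and>
       ln (Re (cr (h (vtx z)) (h (vtx (w + z))) (h (vtx w)) (h (vtx (w - z))))) = ln (Re (cr (h a) (h b) (h c) (h d)))"
    using farey_quad_vtx[OF assms] by blast
next
  fix s assume "\<exists>a b c d. farey_quad a b c d \<and> {vtx z, vtx w} = {a, c} \<and> s = ln (Re (cr (h a) (h b) (h c) (h d)))"
  then obtain a b c d where q: "farey_quad a b c d" "{vtx z, vtx w} = {a, c}"
    and s: "s = ln (Re (cr (h a) (h b) (h c) (h d)))" by blast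
  from q(2) consider "a = vtx z" "c = vtx w" | "a = vtx w" "c = vtx z" by (auto simp: doubleton_eq_iff)
  then show "s = ln (Re (cr (h (vtx z)) (h (vtx (w + z))) (h (vtx w)) (h (vtx (w - z)))))"
  proof cases
    case 1
    then show ?thesis using farey_quad_vtx_unique[OF assms] q s by blast
  next
    case 2
    \<comment> \<open>Writing \<open>vtx z\<close> as \<open>vtx (- z)\<close> brings in the pair
      \<open>w, - z\<close>, to which uniqueness applies; it returns the same quadrilateral turned
      by half.\<close>
    then have "farey_quad (vtx w) b (vtx (- z)) d" using q by simp
    then have "b = vtx (- z + w) \<and> d = vtx (- z - w)"
      using farey_quad_vtx_unique[OF farey_pair_rot[OF assms]] by blast
    moreover have "- z - w = - (w + z)" "- z + w = w - z" by simp_all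
    then have "vtx (- z - w) = vtx (w + z)" "- z + w = w - z" using vtx_minus by metis+
    ultimately show ?thesis using 2 s cr_rotate2 by metis
  qed
qed

lemma circle_homeo_ccw4:
  assumes "circle_homeo_op h" "ccw4 a b c d"
  shows "ccw4 (h a) (h b) (h c) (h d)"
proof -
  obtain g \<phi> where g: "homeomorphism unit_circle unit_circle h g"
    and phi: "continuous_on UNIV \<phi>" "strict_mono \<phi>" "\<And>t::real. h (cis t) = cis (\<phi> t)"
    using assms(1) unfolding circle_homeo_op_def by blast
  obtain t1 t2 t3 t4 where t: "t1 < t2" "t2 < t3" "t3 < t4" "t4 < t1 + 2 * pi"
    "a = cis t1" "b = cis t2" "c = cis t3" "d = cis t4" using assms(2) unfolding ccw4_def by blast
  \<comment> \<open>Monotonicity of the lift does not bound the total turn. If it reached a full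
    turn, an intermediate point would have the same image as \<open>t1\<close>, against
    injectivity.\<close>
  have "\<phi> t4 < \<phi> t1 + 2 * pi"
  proof (rule ccontr)
    assume "\<not> \<phi> t4 < \<phi> t1 + 2 * pi"
    moreover have "continuous_on {t1..t4} \<phi>" using phi(1) continuous_on_subset by blast
    ultimately obtain x where x: "t1 \<le> x" "x \<le> t4" "\<phi> x = \<phi> t1 + 2 * pi"
      using IVT'[of \<phi> t1 "\<phi> t1 + 2 * pi" t4] t pi_gt_zero by (auto simp del: pi_gt_zero)
    then have "h (cis x) = h (cis t1)" using phi(3) by (simp add: complex_eq_iff)
    then have "cis x = cis t1" using g by (metis homeomorphism_apply1 dist_0_norm norm_cis mem_sphere)
    moreover have "x \<noteq> t1" using x(3) by auto
    then have "sin ((x - t1) / 2) > 0" using x t by (intro sin_gt_zero) auto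
    then have "cis t1 \<noteq> cis x" using dist_cis[of t1 x] by auto
    ultimately show False by simp
  qed
  moreover have "\<phi> t1 < \<phi> t2" "\<phi> t2 < \<phi> t3" "\<phi> t3 < \<phi> t4"
    using t phi(2) by (auto simp: strict_mono_def)
  ultimately show ?thesis unfolding ccw4_def using t phi(3) by blast
qed

lemma shear_vtx_dist:
  assumes "farey_pair z w" "circle_homeo_op h"
  shows "shear h {vtx z, vtx w} =
    ln (dist (h (vtx z)) (h (vtx (w + z))) * dist (h (vtx w)) (h (vtx (w - z))) /
        (dist (h (vtx (w + z))) (h (vtx w)) * dist (h (vtx z)) (h (vtx (w - z)))))"
proof -
  have "ccw4 (h (vtx z)) (h (vtx (w + z))) (h (vtx w)) (h (vtx (w - z)))"
    using circle_homeo_ccw4[OF assms(2)] farey_quad_vtx[OF assms(1)] by (simp add: farey_quad_def)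
  from cr_ccw4[OF this] shear_vtx[OF assms(1)] show ?thesis by simp
qed

section \<open>Circle maps with Hoelder continuous derivative\<close>

text \<open>Jordan's inequality with a rougher constant: multiply
  \<open>y / 2 <= tan (y / 2)\<close> by the squared cosine of \<open>y / 2\<close>, which is at
  least 1/2 because \<open>cos y\<close> is nonnegative.\<close>

lemma abs_le_sin:
  fixes x :: real
  assumes "\<bar>x\<bar> \<le> pi / 2"
  shows "\<bar>x\<bar> \<le> 2 * \<bar>sin x\<bar>"
proof -
  have *: "y \<le> 2 * sin y" if y: "0 \<le> y" "y \<le> pi / 2" for y :: real
  proof -
    have c: "cos (y / 2) > 0" using y pi_gt_zero by (intro cos_gt_zero_pi) linarith+
    have "y / 2 \<le> tan (y / 2)"
      using abs_tan_ge[of "y / 2"] y tan_pos_pi2_le[of "y / 2"] pi_gt_zero by (simp del: pi_gt_zero)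
    then have "y / 2 * (cos (y / 2))\<^sup>2 \<le> tan (y / 2) * (cos (y / 2))\<^sup>2"
      by (intro mult_right_mono) auto
    also have "\<dots> = sin y / 2"
      using c sin_double[of "y / 2"] by (simp add: tan_def power2_eq_square)
    finally have "y * (cos (y / 2))\<^sup>2 \<le> sin y" by simp
    moreover have "(cos (y / 2))\<^sup>2 \<ge> 1 / 2"
      using cos_double_cos[of "y / 2"] cos_ge_zero[of y] y by simp
    then have "y * (cos (y / 2))\<^sup>2 \<ge> y * (1 / 2)" using y by (intro mult_left_mono) auto
    ultimately show ?thesis by linarith
  qed
  show ?thesis using *[of x] *[of "- x"] assms by (cases "x \<ge> 0") auto
qed

text \<open>The argument nearest to \<open>s\<close> makes arc and chord comparable, so that
  estimates can pass between angles and points.\<close>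

lemma circle_chord:
  assumes "cmod b = 1"
  obtains t where "b = cis t" "\<bar>t - s\<bar> \<le> pi" "\<bar>t - s\<bar> \<le> 2 * dist (cis s) b"
proof -
  define u where "u = b / cis s"
  have u: "cmod u = 1" using assms by (simp add: u_def norm_divide)
  then have "u \<noteq> 0" by auto
  then have c: "u = cis (Arg u)" using u by (simp add: cis_Arg sgn_div_norm)
  define t where "t = s + Arg u"
  have b: "b = cis t" using c unfolding u_def t_def cis_mult[symmetric] by (simp add: field_simps)
  have p: "\<bar>t - s\<bar> \<le> pi" using Arg_bounded[of u] unfolding t_def by auto
  have "\<bar>t - s\<bar> \<le> 2 * dist (cis s) b"
    using abs_le_sin[of "(t - s) / 2"] p by (simp add: b dist_cis)
  then show ?thesis using that b p by blast
qed

lemma dist_cis_le: "dist (cis s) (cis t) \<le> \<bar>t - s\<bar>"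
  using abs_sin_x_le_abs_x[of "(t - s) / 2"] by (simp add: dist_cis)

lemma norm_exp_diff_le:
  fixes x y :: complex
  assumes "cmod x \<le> M" "cmod y \<le> M"
  shows "cmod (exp x - exp y) \<le> exp M * cmod (x - y)"
proof (rule field_differentiable_bound[of "cball 0 M" exp exp])
  show "cmod (exp z) \<le> exp M" if "z \<in> cball 0 M" for z
    using that norm_exp[of z] by (simp add: order_trans)
qed (use assms in \<open>auto intro!: derivative_eq_intros\<close>)

lemma abs_ln_le:
  fixes x :: real
  assumes "\<bar>x\<bar> \<le> 1 / 2"
  shows "\<bar>ln (1 + x)\<bar> \<le> 2 * \<bar>x\<bar>"
proof -
  have "\<bar>ln (1 + x) - x\<bar> \<le> 2 * (\<bar>x\<bar> * \<bar>x\<bar>)"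
    using abs_ln_one_plus_x_minus_x_bound[OF assms] by (simp add: power2_eq_square abs_mult_self_eq)
  moreover have "\<bar>x\<bar> * \<bar>x\<bar> \<le> \<bar>x\<bar> * (1 / 2)" using assms by (intro mult_left_mono) auto
  ultimately show ?thesis by linarith
qed

section \<open>Chord stretching and its Hoelder estimates\<close>

locale smooth_circle_map =
  fixes h L :: "complex \<Rightarrow> complex" and \<alpha> C :: real
  assumes homeo: "circle_homeo_op h"
    and alpha: "0 < \<alpha>"
    and C_nonneg: "0 \<le> C"
    and deriv: "z \<in> unit_circle \<Longrightarrow> (h has_field_derivative exp (L z)) (at z within unit_circle)"
    and holder: "\<lbrakk>z \<in> unit_circle; w \<in> unit_circle\<rbrakk> \<Longrightarrow> dist (L z) (L w) \<le> C * dist z w powr \<alpha>"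
begin

definition stretch :: "complex \<Rightarrow> complex \<Rightarrow> real" where
  "stretch a b = dist (h a) (h b) / dist a b"

lemma stretch_commute: "stretch a b = stretch b a"
  by (simp add: stretch_def dist_commute)

lemma h_inj:
  assumes "a \<in> unit_circle" "b \<in> unit_circle" "a \<noteq> b"
  shows "h a \<noteq> h b"
  using homeo assms unfolding circle_homeo_op_def by (metis homeomorphism_apply1)

lemma stretch_pos:
  assumes "a \<in> unit_circle" "b \<in> unit_circle" "a \<noteq> b"
  shows "stretch a b > 0"
  using h_inj[OF assms] assms by (simp add: stretch_def)

lemma L_bounded: "\<exists>M. \<forall>z\<in>unit_circle. cmod (L z) \<le> M"
proof -
  have "cmod (L z) \<le> cmod (L 1) + C * 2 powr \<alpha>" if z: "z \<in> unit_circle" for z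
  proof -
    have "dist z 1 \<le> 2" using z dist_triangle[of z 1 0] by (simp add: dist_commute)
    then have "C * dist z 1 powr \<alpha> \<le> C * 2 powr \<alpha>"
      using C_nonneg alpha by (intro mult_left_mono powr_mono2) auto
    then show ?thesis
      using holder[of z 1] z norm_triangle_ineq2[of "L z" "L 1"] by (simp add: dist_norm)
  qed
  then show ?thesis by blast
qed

text \<open>The estimate is made in the angle, since the mean value inequality wants a convex
  domain. Passing from arc to chord costs two factors in \<open>K\<close>, namely
  \<open>2 powr \<alpha>\<close> and \<open>2\<close>.\<close>

lemma linear_approx:
  "\<exists>K\<ge>0. \<forall>a\<in>unit_circle. \<forall>b\<in>unit_circle.
    cmod (h b - h a - exp (L a) * (b - a)) \<le> K * dist a b powr \<alpha> * dist a b"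
proof -
  obtain M where M: "\<And>z. z \<in> unit_circle \<Longrightarrow> cmod (L z) \<le> M" using L_bounded by metis
  define K where "K = exp M * C * 2 powr \<alpha> * 2"
  have bound: "cmod (h b - h a - exp (L a) * (b - a)) \<le> K * dist a b powr \<alpha> * dist a b"
    if a: "a \<in> unit_circle" and b: "b \<in> unit_circle" for a b
  proof -
    obtain s where s: "a = cis s" using circle_eq_cis[of a] a by auto
    obtain t where t: "b = cis t" "\<bar>t - s\<bar> \<le> 2 * dist (cis s) b" using circle_chord[of b s] b by auto
    \<comment> \<open>Subtracting the linear map makes the derivative in the angle vanish at
      \<open>s\<close>; along the arc it then stays below the Hoelder bound
      \<open>B\<close>.\<close>
    define g where "g = (\<lambda>r. h (cis r) - exp (L a) * cis r)"
    define g' where "g' = (\<lambda>r. (exp (L (cis r)) - exp (L a)) * (\<i> * cis r))"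
    define B where "B = exp M * (C * (2 * dist a b) powr \<alpha>)"
    have "(g has_vector_derivative g' r) (at r within closed_segment s t)" for r
    proof -
      have c: "(cis has_vector_derivative \<i> * cis r) (at r within closed_segment s t)"
        using has_derivative_cis[of "\<lambda>x. x" "\<lambda>x. x" r "closed_segment s t"]
        by (simp add: has_vector_derivative_def scaleR_conv_of_real mult_ac)
      have "(h has_field_derivative exp (L (cis r))) (at (cis r) within cis ` closed_segment s t)"
        by (rule DERIV_subset[OF deriv]) auto
      from field_vector_diff_chain_within[OF c this] c show ?thesis
        unfolding g_def g'_def o_def
        by (auto intro!: derivative_eq_intros simp: algebra_simps)
    qed
    moreover have "cmod (g' r - g' s) \<le> B" if r: "r \<in> closed_segment s t" for r
    proof -
      have "\<bar>r - s\<bar> \<le> \<bar>t - s\<bar>" using r by (auto simp: closed_segment_eq_real_ivl split: if_splits)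
      then have "dist a (cis r) \<le> 2 * dist a b" using dist_cis_le[of s r] t s by simp
      then have "C * dist (cis r) a powr \<alpha> \<le> C * (2 * dist a b) powr \<alpha>"
        using C_nonneg alpha by (intro mult_left_mono powr_mono2) (auto simp: dist_commute)
      then have "cmod (L (cis r) - L a) \<le> C * (2 * dist a b) powr \<alpha>"
        using holder[of "cis r" a] a by (simp add: dist_norm)
      then have "exp M * cmod (L (cis r) - L a) \<le> B" unfolding B_def by (intro mult_left_mono) auto
      then have "cmod (exp (L (cis r)) - exp (L a)) \<le> B"
        using norm_exp_diff_le[OF M M, of "cis r" a] a by simp
      then show ?thesis by (simp add: g'_def s norm_mult)
    qed
    ultimately have "cmod (g t - g s - (t - s) *\<^sub>R g' s) \<le> \<bar>t - s\<bar> * B"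
      using vector_differentiable_bound_linearization[of "closed_segment s t" g g' s t s B] by auto
    moreover have "g t - g s - (t - s) *\<^sub>R g' s = h b - h a - exp (L a) * (b - a)"
      unfolding g_def g'_def s t by (simp add: algebra_simps)
    moreover have "\<bar>t - s\<bar> * B \<le> 2 * dist a b * B"
      using t s C_nonneg unfolding B_def by (intro mult_right_mono) auto
    moreover have "2 * dist a b * B = K * dist a b powr \<alpha> * dist a b"
      unfolding B_def K_def by (simp add: powr_mult)
    ultimately show ?thesis by simp
  qed
  have "K \<ge> 0" using C_nonneg by (simp add: K_def)
  with bound show ?thesis by blast
qed

lemma stretch_approx:
  "\<exists>K\<ge>0. \<forall>a\<in>unit_circle. \<forall>b\<in>unit_circle. a \<noteq> b \<longrightarrow>
    \<bar>stretch a b - exp (Re (L a))\<bar> \<le> K * dist a b powr \<alpha>"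
proof -
  obtain K where K: "K \<ge> 0" "\<And>a b. \<lbrakk>a \<in> unit_circle; b \<in> unit_circle\<rbrakk> \<Longrightarrow>
    cmod (h b - h a - exp (L a) * (b - a)) \<le> K * dist a b powr \<alpha> * dist a b"
    using linear_approx by metis
  have "\<bar>stretch a b - exp (Re (L a))\<bar> \<le> K * dist a b powr \<alpha>"
    if "a \<in> unit_circle" "b \<in> unit_circle" "a \<noteq> b" for a b
  proof -
    have d: "dist a b > 0" using that by simp
    have "\<bar>dist (h a) (h b) - exp (Re (L a)) * dist a b\<bar> = \<bar>cmod (h b - h a) - cmod (exp (L a) * (b - a))\<bar>"
      by (simp add: dist_norm norm_minus_commute norm_mult)
    also have "\<dots> \<le> K * dist a b powr \<alpha> * dist a b"
      using norm_triangle_ineq3 K(2)[OF that(1,2)] by (rule order_trans)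
    finally have "\<bar>stretch a b - exp (Re (L a))\<bar> * dist a b \<le> K * dist a b powr \<alpha> * dist a b"
      using d by (simp add: stretch_def abs_mult[of _ "dist a b", simplified, symmetric] left_diff_distrib)
    then show ?thesis using d by (simp only: mult_le_cancel_right_pos)
  qed
  then show ?thesis using K(1) by blast
qed

text \<open>Both points move, as for consecutive points of a fan, so differentiability at
  \<open>v\<close> alone would not do. The uniform estimate centred at \<open>f x\<close> is
  combined with continuity of \<open>L\<close>.\<close>

lemma stretch_tendsto:
  assumes "(f \<longlongrightarrow> v) F" "(g \<longlongrightarrow> v) F" "\<forall>\<^sub>F x in F. f x \<in> unit_circle \<and> g x \<in> unit_circle \<and> f x \<noteq> g x"
    and v: "v \<in> unit_circle"
  shows "((\<lambda>x. stretch (f x) (g x)) \<longlongrightarrow> exp (Re (L v))) F"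
proof -
  obtain K where K: "\<And>a b. \<lbrakk>a \<in> unit_circle; b \<in> unit_circle; a \<noteq> b\<rbrakk> \<Longrightarrow>
    \<bar>stretch a b - exp (Re (L a))\<bar> \<le> K * dist a b powr \<alpha>" using stretch_approx by metis
  have powr0: "((\<lambda>x. dist (f x) (g x) powr \<alpha>) \<longlongrightarrow> 0) F" if "(f \<longlongrightarrow> v) F" "(g \<longlongrightarrow> v) F" for f g :: "_ \<Rightarrow> complex"
  proof -
    have "((\<lambda>x. dist (f x) (g x)) \<longlongrightarrow> dist v v) F" by (intro tendsto_intros that)
    then have "((\<lambda>x. dist (f x) (g x) powr \<alpha>) \<longlongrightarrow> 0 powr \<alpha>) F"
      using alpha by (intro tendsto_powr') auto
    then show ?thesis by simp
  qed
  have K0: "((\<lambda>x. K * dist (f x) (g x) powr \<alpha>) \<longlongrightarrow> 0) F"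
    using tendsto_mult_left[OF powr0[OF assms(1,2)], of K] by simp
  have "\<forall>\<^sub>F x in F. norm (stretch (f x) (g x) - exp (Re (L (f x)))) \<le> K * dist (f x) (g x) powr \<alpha>"
    using assms(3) by (rule eventually_mono) (simp add: K)
  then have 1: "((\<lambda>x. stretch (f x) (g x) - exp (Re (L (f x)))) \<longlongrightarrow> 0) F" by (rule Lim_null_comparison[OF _ K0])
  have C0: "((\<lambda>x. C * dist (f x) v powr \<alpha>) \<longlongrightarrow> 0) F"
    using tendsto_mult_left[OF powr0[OF assms(1) tendsto_const], of C] by simp
  have "\<forall>\<^sub>F x in F. norm (dist (L (f x)) (L v)) \<le> C * dist (f x) v powr \<alpha>"
    using assms(3) by (rule eventually_mono) (use holder v in simp)
  then have "((\<lambda>x. dist (L (f x)) (L v)) \<longlongrightarrow> 0) F" by (rule Lim_null_comparison[OF _ C0])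
  then have "((\<lambda>x. L (f x)) \<longlongrightarrow> L v) F" by (rule tendsto_dist_iff[THEN iffD2])
  then have "((\<lambda>x. exp (Re (L (f x)))) \<longlongrightarrow> exp (Re (L v))) F" by (intro tendsto_intros)
  from tendsto_add[OF 1 this] show ?thesis by simp
qed

lemma ln_stretch_approx:
  "\<exists>K\<ge>0. \<forall>a\<in>unit_circle. \<forall>b\<in>unit_circle. a \<noteq> b \<longrightarrow> K * dist a b powr \<alpha> \<le> 1 \<longrightarrow>
    \<bar>(Re (L a) + Re (L b)) / 2 - ln (stretch a b)\<bar> \<le> K * dist a b powr \<alpha>"
proof -
  obtain K where K: "K \<ge> 0" "\<And>a b. \<lbrakk>a \<in> unit_circle; b \<in> unit_circle; a \<noteq> b\<rbrakk> \<Longrightarrow>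
    \<bar>stretch a b - exp (Re (L a))\<bar> \<le> K * dist a b powr \<alpha>" using stretch_approx by metis
  obtain M where M: "\<And>z. z \<in> unit_circle \<Longrightarrow> cmod (L z) \<le> M" using L_bounded by metis
  \<comment> \<open>The first summand pays for the logarithm, the second for replacing
    \<open>Re (L a)\<close> by the average over both ends. Smallness of
    \<open>K' * dist a b powr \<alpha>\<close> also gives \<open>2 * |x| <= 1\<close>, as
    \<open>abs_ln_le\<close> demands.\<close>
  define K' where "K' = 2 * exp M * K + C"
  have "\<bar>(Re (L a) + Re (L b)) / 2 - ln (stretch a b)\<bar> \<le> K' * dist a b powr \<alpha>"
    if a: "a \<in> unit_circle" "b \<in> unit_circle" "a \<noteq> b" and s: "K' * dist a b powr \<alpha> \<le> 1" for a b
  proof -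
    define x where "x = stretch a b * exp (- Re (L a)) - 1"
    have x_eq: "x = (stretch a b - exp (Re (L a))) * exp (- Re (L a))"
      by (simp add: x_def algebra_simps exp_minus)
    have "exp (- Re (L a)) \<le> exp M"
      using M[OF a(1)] abs_Re_le_cmod[of "L a"] by simp
    then have "\<bar>x\<bar> \<le> (K * dist a b powr \<alpha>) * exp M"
      using K(2)[OF a] K(1) unfolding x_eq abs_mult by (intro mult_mono) auto
    then have x: "2 * \<bar>x\<bar> \<le> 2 * exp M * K * dist a b powr \<alpha>" by (simp add: mult_ac)
    have nn: "C * dist a b powr \<alpha> \<ge> 0" using C_nonneg by simp
    have kk: "K' * dist a b powr \<alpha> = 2 * exp M * K * dist a b powr \<alpha> + C * dist a b powr \<alpha>"
      by (simp add: K'_def algebra_simps)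
    have l: "\<bar>ln (1 + x)\<bar> \<le> 2 * \<bar>x\<bar>" using x nn kk s by (intro abs_ln_le) linarith
    have "ln (1 + x) = ln (stretch a b) - Re (L a)"
      using stretch_pos[OF a] by (simp add: x_def ln_mult)
    moreover have "\<bar>Re (L a) - Re (L b)\<bar> \<le> C * dist a b powr \<alpha>"
      using holder[OF a(1,2)] abs_Re_le_cmod[of "L a - L b"] by (simp add: dist_norm)
    ultimately show ?thesis using l x kk nn by (simp only: abs_le_iff) (auto simp: field_simps)
  qed
  moreover have "K' \<ge> 0" using K(1) C_nonneg by (simp add: K'_def)
  ultimately show ?thesis by blast
qed

end

lemma C1_circle_imp_smooth:
  assumes "h \<in> C1_circle \<alpha>" "0 < \<alpha>"
  obtains L C where "smooth_circle_map h L \<alpha> C"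
proof -
  obtain L C where L: "circle_homeo_op h"
    "\<forall>z\<in>unit_circle. (h has_field_derivative exp (L z)) (at z within unit_circle)"
    and LC: "\<forall>z\<in>unit_circle. \<forall>w\<in>unit_circle. dist (L z) (L w) \<le> C * dist z w powr \<alpha>"
    using assms(1) unfolding C1_circle_def holder_on_def by auto
  have "dist (L z) (L w) \<le> \<bar>C\<bar> * dist z w powr \<alpha>" if "z\<in>unit_circle" "w\<in>unit_circle" for z w
    using LC that mult_right_mono[OF abs_ge_self[of C], of "dist z w powr \<alpha>"]
    by (meson order_trans powr_ge_zero)
  then have "smooth_circle_map h L \<alpha> \<bar>C\<bar>" using L assms(2) by unfold_locales auto
  then show ?thesis using that by blast
qed

section \<open>Shear sums along fans\<close>

lemma filterlim_abs_of_int_shift: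
  assumes "filterlim (\<lambda>x. \<bar>real_of_int (f x)\<bar>) at_top F"
  shows "filterlim (\<lambda>x. \<bar>real_of_int (f x + c)\<bar>) at_top F"
proof (rule filterlim_at_top_mono)
  show "filterlim (\<lambda>x. - \<bar>real_of_int c\<bar> + \<bar>real_of_int (f x)\<bar>) at_top F"
    by (rule filterlim_tendsto_add_at_top[OF tendsto_const assms])
  have "- \<bar>real_of_int c\<bar> + \<bar>real_of_int n\<bar> \<le> \<bar>real_of_int (n + c)\<bar>" for n by simp
  then show "\<forall>\<^sub>F x in F. - \<bar>real_of_int c\<bar> + \<bar>real_of_int (f x)\<bar> \<le> \<bar>real_of_int (f x + c)\<bar>"
    by (intro always_eventually) blast
qed

lemma filterlim_abs_of_int_seq:
  "filterlim (\<lambda>k. \<bar>real_of_int (int k)\<bar>) at_top sequentially"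
  "filterlim (\<lambda>k. \<bar>real_of_int (- int k)\<bar>) at_top sequentially"
  by (simp_all add: filterlim_real_sequentially)

text \<open>The modulus of \<open>w - n z\<close> grows linearly in \<open>|n|\<close>. The absolute
  value in the hypothesis treats both ends of the fan at once.\<close>

lemma vtx_shift_tendsto:
  assumes "unimod z w" "filterlim (\<lambda>x. \<bar>real_of_int (f x)\<bar>) at_top F"
  shows "((\<lambda>x. vtx (w - of_int (f x) * z)) \<longlongrightarrow> vtx z) F"
proof -
  have u: "unimod z (w - of_int n * z)" for n :: int
    using unimod_add[OF assms(1), of "- n"] by simp
  note nz = unimod_neq_0[OF u]
  have d: "dist (vtx (w - of_int n * z)) (vtx z) = 2 / (cmod z * cmod (w - of_int n * z))" for n :: int
    using dist_vtx[OF nz(1,2), of n] u[of n] by (simp add: dist_commute unimod_def)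
  have "filterlim (\<lambda>x. - cmod w + cmod z * \<bar>real_of_int (f x)\<bar>) at_top F"
    using nz(1) assms(2)
    by (intro filterlim_tendsto_add_at_top[OF tendsto_const] filterlim_tendsto_pos_mult_at_top[OF tendsto_const]) auto
  then have "filterlim (\<lambda>x. cmod (w - of_int (f x) * z)) at_top F"
  proof (rule filterlim_at_top_mono, intro always_eventually allI)
    fix x
    show "- cmod w + cmod z * \<bar>real_of_int (f x)\<bar> \<le> cmod (w - of_int (f x) * z)"
      using norm_triangle_ineq3[of "of_int (f x) * z" w] by (simp add: norm_mult norm_minus_commute mult.commute)
  qed
  then have "filterlim (\<lambda>x. cmod z * cmod (w - of_int (f x) * z)) at_top F"
    using nz(1) by (intro filterlim_tendsto_pos_mult_at_top[OF tendsto_const]) auto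
  then have "((\<lambda>x. 2 / (cmod z * cmod (w - of_int (f x) * z))) \<longlongrightarrow> 0) F"
    by (intro tendsto_divide_0[OF tendsto_const] filterlim_at_top_imp_at_infinity)
  then show ?thesis by (subst tendsto_dist_iff) (simp add: d)
qed

lemma sum_telescope_int:
  fixes G :: "int \<Rightarrow> real"
  shows "(\<Sum>k = - int n..-1. G k - G (k - 1)) = G (- 1) - G (- int n - 1)"
    and "(\<Sum>k = 0..int n. G k - G (k - 1)) = G (int n) - G (- 1)"
proof (induction n)
  case (Suc n)
  have "{- int (Suc n)..-1} = insert (- int n - 1) {- int n..-1}"
    "{0..int (Suc n)} = insert (1 + int n) {0..int n}" by auto
  then show "(\<Sum>k = - int (Suc n)..-1. G k - G (k - 1)) = G (- 1) - G (- int (Suc n) - 1)"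
    "(\<Sum>k = 0..int (Suc n). G k - G (k - 1)) = G (int (Suc n)) - G (- 1)"
    using Suc.IH by (simp_all add: add.commute)
qed simp_all

context smooth_circle_map begin

text \<open>If \<open>h\<close> is conjugated to fix infinity at \<open>vtx z\<close>, \<open>fan_step z w n\<close> is, up to a constant, the
  logarithm of the distance between the images of two consecutive endpoints of the fan; shears are
  the differences of consecutive steps.\<close>

definition fan_step :: "complex \<Rightarrow> complex \<Rightarrow> int \<Rightarrow> real" where
  "fan_step z w n = ln (dist (h (vtx (w - of_int n * z))) (h (vtx (w - of_int (n + 1) * z))) /
     (dist (h (vtx z)) (h (vtx (w - of_int n * z))) * dist (h (vtx z)) (h (vtx (w - of_int (n + 1) * z)))))"

lemma unimod_shift_circle:
  assumes "unimod z w"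
  shows "vtx z \<in> unit_circle" "vtx (w - of_int n * z) \<in> unit_circle"
    "vtx z \<noteq> vtx (w - of_int n * z)" "vtx (w - of_int n * z) \<noteq> vtx (w - of_int (n + 1) * z)"
proof -
  have u: "unimod z (w - of_int k * z)" for k :: int
    using unimod_add[OF assms, of "- k"] by simp
  show "vtx z \<in> unit_circle" "vtx (w - of_int n * z) \<in> unit_circle"
    using unimod_neq_0[OF u] by (simp_all add: norm_vtx)
  show "vtx z \<noteq> vtx (w - of_int n * z)" using u[of n] by (intro vtx_neq) (simp add: unimod_def)
  have "cross (w - of_int n * z) (w - of_int (n + 1) * z) = cross z w"
    by (simp add: cross_eq algebra_simps)
  then show "vtx (w - of_int n * z) \<noteq> vtx (w - of_int (n + 1) * z)"
    using assms by (intro vtx_neq) (simp add: unimod_def)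
qed

lemma shear_fan:
  assumes "farey_pair z w"
  shows "shear h {vtx z, vtx (w - of_int n * z)} = fan_step z w n - fan_step z w (n - 1)"
proof -
  have u: "unimod z w" using assms by (simp add: farey_pair_def)
  note uc = unimod_shift_circle[OF u]
  define y where "y = (\<lambda>k::int. vtx (w - of_int k * z))"
  have yc: "y k \<in> unit_circle" "vtx z \<noteq> y k" "y k \<noteq> y (k + 1)" for k
    unfolding y_def by (rule uc)+
  define v a b c where "v = h (vtx z)" and "a = h (y (n - 1))"
    and "b = h (y n)" and "c = h (y (n + 1))"
  have pos: "dist v a > 0" "dist v b > 0" "dist v c > 0" "dist a b > 0" "dist b c > 0"
    unfolding v_def a_def b_def c_def zero_less_dist_iff
    using h_inj[OF uc(1) yc(1) yc(2)] h_inj[OF yc(1) yc(1) yc(3)] h_inj[OF yc(1) yc(1) yc(3)[of "n - 1"]]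
    by auto
  have p: "farey_pair z (w - of_int n * z)" using farey_pair_shift[OF assms, of "- n"] by simp
  have e: "w - of_int n * z + z = w - of_int (n - 1) * z" "w - of_int n * z - z = w - of_int (n + 1) * z"
    by (simp_all add: algebra_simps)
  have "shear h {vtx z, vtx (w - of_int n * z)} = ln (dist v a * dist b c / (dist a b * dist v c))"
    using shear_vtx_dist[OF p homeo] unfolding e v_def a_def b_def c_def y_def .
  \<comment> \<open>The factor \<open>dist v b\<close>, inserted in both quotients, cancels and
    gives each the shape of a \<open>fan_step\<close>.\<close>
  also have "\<dots> = ln (dist b c / (dist v b * dist v c)) - ln (dist a b / (dist v a * dist v b))"
    using pos by (simp add: ln_div ln_mult)
  finally show ?thesis unfolding fan_step_def v_def a_def b_def c_def y_def by simp
qed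

text \<open>For the identity map the step does not depend on \<open>n\<close>: its value
  \<open>ln ((cmod z)\<^sup>2 / 2)\<close> follows from \<open>dist_vtx\<close>, where all
  determinants are 1. The rest measures how \<open>h\<close> stretches the three chords.\<close>

lemma fan_step_eq:
  assumes "unimod z w"
  shows "fan_step z w n = ln (stretch (vtx (w - of_int n * z)) (vtx (w - of_int (n + 1) * z)))
    - ln (stretch (vtx z) (vtx (w - of_int n * z))) - ln (stretch (vtx z) (vtx (w - of_int (n + 1) * z)))
    + ln ((cmod z)\<^sup>2 / 2)"
proof -
  note uc = unimod_shift_circle[OF assms]
  define y where "y = (\<lambda>k::int. vtx (w - of_int k * z))"
  have yc: "y k \<in> unit_circle" "vtx z \<noteq> y k" "y k \<noteq> y (k + 1)" for k
    unfolding y_def by (rule uc)+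
  define v a b where "v = vtx z" and "a = y n" and "b = y (n + 1)"
  have ab: "a = vtx (w - of_int n * z)" "b = vtx (w - of_int (n + 1) * z)"
    by (simp_all only: a_def b_def y_def)
  have u: "unimod z (w - of_int k * z)" for k :: int
    using unimod_add[OF assms, of "- k"] by simp
  note nz = unimod_neq_0[OF u]
  have c: "cross z (w - of_int n * z) = 1" "cross z (w - of_int (n + 1) * z) = 1"
    "cross (w - of_int n * z) (w - of_int (n + 1) * z) = 1"
    using assms by (simp_all add: unimod_def cross_eq algebra_simps)
  have pos: "dist (h v) (h a) > 0" "dist (h v) (h b) > 0" "dist (h a) (h b) > 0"
    "dist v a > 0" "dist v b > 0" "dist a b > 0"
    unfolding v_def a_def b_def zero_less_dist_iff
    using h_inj[OF uc(1) yc(1) yc(2)] h_inj[OF yc(1) yc(1) yc(3)] yc by auto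
  have quot: "2 * \<bar>1\<bar> / (cmod (w - of_int n * z) * cmod (w - of_int (n + 1) * z)) /
      (2 * \<bar>1\<bar> / (cmod z * cmod (w - of_int n * z)) * (2 * \<bar>1\<bar> / (cmod z * cmod (w - of_int (n + 1) * z))))
      = (cmod z)\<^sup>2 / 2"
    using nz(1) nz(2)[of n] nz(2)[of "n + 1"]
    by (simp add: divide_simps power2_eq_square del: of_int_add)
  have "dist a b / (dist v a * dist v b) = (cmod z)\<^sup>2 / 2"
    unfolding v_def ab dist_vtx[OF nz(1,2)] dist_vtx[OF nz(2,2)] c by (rule quot)
  moreover have "ln (dist a b / (dist v a * dist v b)) = ln (dist a b) - ln (dist v a) - ln (dist v b)"
    using pos by (simp add: ln_div ln_mult)
  ultimately have "ln ((cmod z)\<^sup>2 / 2) = ln (dist a b) - ln (dist v a) - ln (dist v b)" by (simp only:)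
  moreover have "fan_step z w n = ln (dist (h a) (h b)) - ln (dist (h v) (h a)) - ln (dist (h v) (h b))"
    unfolding fan_step_def v_def[symmetric] ab[symmetric]
    using pos by (simp add: ln_div ln_mult)
  ultimately show ?thesis
    unfolding v_def[symmetric] ab[symmetric]
    using pos by (simp add: stretch_def ln_div ln_mult)
qed

text \<open>The three stretches share one limit and enter with signs +, -, -, so a single negative
  copy survives.\<close>

lemma fan_step_tendsto:
  assumes "unimod z w" "filterlim (\<lambda>x. \<bar>real_of_int (f x)\<bar>) at_top F"
  shows "((\<lambda>x. fan_step z w (f x)) \<longlongrightarrow> ln ((cmod z)\<^sup>2 / 2) - Re (L (vtx z))) F"
proof -
  note uc = unimod_shift_circle[OF assms(1)]
  note t0 = vtx_shift_tendsto[OF assms]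
  note t1 = vtx_shift_tendsto[OF assms(1) filterlim_abs_of_int_shift[OF assms(2), of 1]]
  have "((\<lambda>x. fan_step z w (f x)) \<longlongrightarrow> ln (exp (Re (L (vtx z)))) - ln (exp (Re (L (vtx z))))
      - ln (exp (Re (L (vtx z)))) + ln ((cmod z)\<^sup>2 / 2)) F"
    unfolding fan_step_eq[OF assms(1)]
    by (intro tendsto_add tendsto_diff tendsto_ln stretch_tendsto t0 t1 tendsto_const uc(1)
        always_eventually allI conjI uc(2-4)) auto
  then show ?thesis by (simp add: algebra_simps)
qed

text \<open>Partial sums telescope to differences of steps, and the steps converge at both ends of
  the fan; any positive exponent suffices here.\<close>

lemma shear_in_P: "shear h \<in> shear_P"
  unfolding shear_P_def
proof (intro CollectI ballI)
  fix v assume "v \<in> farey_vertices"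
  then obtain z w where p: "farey_pair z w" "v = vtx z" by (rule farey_vertex_pair)
  have u: "unimod z w" using p by (simp add: farey_pair_def)
  obtain m where m: "\<And>n. fan_edge v n = {vtx z, vtx (w - of_int (n - m) * z)}"
    using fan_edge_vtx[OF p(1)] p(2) by metis
  define G where "G = (\<lambda>k. fan_step z w (k + - m))"
  have s: "shear h (fan_edge v k) = G k - G (k - 1)" for k
    unfolding m shear_fan[OF p(1)] G_def by (simp add: algebra_simps)
  have "(\<lambda>n. G (- int n + - 1)) \<longlonglongrightarrow> ln ((cmod z)\<^sup>2 / 2) - Re (L (vtx z))"
    "(\<lambda>n. G (int n)) \<longlonglongrightarrow> ln ((cmod z)\<^sup>2 / 2) - Re (L (vtx z))"
    unfolding G_def
    by (intro fan_step_tendsto[OF u] filterlim_abs_of_int_shift filterlim_abs_of_int_seq)+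
  then have "convergent (\<lambda>n. G (- int n - 1))" "convergent (\<lambda>n. G (int n))"
    by (auto simp: convergent_def)
  then have "convergent (\<lambda>n. G (- 1) - G (- int n - 1))" "convergent (\<lambda>n. G (int n) - G (- 1))"
    using convergent_diff[OF convergent_const] convergent_diff[OF _ convergent_const] by blast+
  then show "convergent (\<lambda>n. \<Sum>k = - int n..-1. shear h (fan_edge v k)) \<and>
     convergent (\<lambda>n. \<Sum>k = 0..int n. shear h (fan_edge v k))"
    unfolding s sum_telescope_int by blast
qed

text \<open>The steps have the same limit \<open>l\<close> at both ends, so the tails are
  \<open>l - fan_step z w 0\<close> and \<open>fan_step z w (- 1) - l\<close>. In the difference
  \<open>ln ((cmod z)\<^sup>2 / 2)\<close> cancels, and only chords of the quadrilateral around the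
  edge remain.\<close>

lemma p_minus_diff_p_plus:
  assumes "farey_pair z w"
  shows "p_minus (shear h) (vtx z) {vtx z, vtx w} - p_plus (shear h) (vtx z) {vtx z, vtx w} =
    ln (stretch (vtx w) (vtx (w + z))) + ln (stretch (vtx w) (vtx (w - z)))
    - ln (stretch (vtx z) (vtx (w + z))) - ln (stretch (vtx z) (vtx (w - z)))
    - 2 * ln (stretch (vtx z) (vtx w)) + 2 * Re (L (vtx z))"
proof -
  have u: "unimod z w" using assms by (simp add: farey_pair_def)
  obtain m where m: "\<And>n. fan_edge (vtx z) n = {vtx z, vtx (w - of_int (n - m) * z)}"
    using fan_edge_vtx[OF assms] by metis
  have pos: "fan_pos (vtx z) {vtx z, vtx w} = m"
    using fan_pos_vtx[OF assms m, of 0] by simp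
  have s: "shear h (fan_edge (vtx z) k) = fan_step z w (k - m) - fan_step z w (k - m - 1)" for k
    unfolding m by (rule shear_fan[OF assms])
  define l where "l = ln ((cmod z)\<^sup>2 / 2) - Re (L (vtx z))"
  have lim: "(\<lambda>n. fan_step z w (int n)) \<longlonglongrightarrow> l" "(\<lambda>n. fan_step z w (- int n + - 1)) \<longlonglongrightarrow> l"
    unfolding l_def
    by (intro fan_step_tendsto[OF u] filterlim_abs_of_int_shift filterlim_abs_of_int_seq)+
  have "p_plus (shear h) (vtx z) {vtx z, vtx w} = (\<Sum>k. fan_step z w (int (Suc k)) - fan_step z w (int k))"
    unfolding p_plus_def pos s by (rule arg_cong[where f = suminf]) (simp add: fun_eq_iff add.commute)
  also have "\<dots> = l - fan_step z w 0" using telescope_sums[OF lim(1)] by (simp add: sums_iff)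
  finally have plus: "p_plus (shear h) (vtx z) {vtx z, vtx w} = l - fan_step z w 0" .
  have "p_minus (shear h) (vtx z) {vtx z, vtx w} =
      (\<Sum>k. fan_step z w (- int k + - 1) - fan_step z w (- int (Suc k) + - 1))"
    unfolding p_minus_def pos s
  proof (rule arg_cong[where f = suminf], rule ext)
    fix k
    have "m - 1 - int k - m = - int k + - 1" "m - 1 - int k - m - 1 = - int (Suc k) + - 1" by simp_all
    then show "fan_step z w (m - 1 - int k - m) - fan_step z w (m - 1 - int k - m - 1) =
        fan_step z w (- int k + - 1) - fan_step z w (- int (Suc k) + - 1)" by (simp only:)
  qed
  also have "\<dots> = fan_step z w (- 1) - l" using telescope_sums'[OF lim(2)] by (simp add: sums_iff)
  finally have minus: "p_minus (shear h) (vtx z) {vtx z, vtx w} = fan_step z w (- 1) - l" .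
  show ?thesis
    unfolding plus minus l_def
    using fan_step_eq[OF u, of 0] fan_step_eq[OF u, of "-1"] stretch_commute by simp
qed

text \<open>The chords to \<open>vtx (w + z)\<close> and \<open>vtx (w - z)\<close> enter with
  opposite signs at the two endpoints and cancel.\<close>

lemma Psi_shear:
  assumes "farey_pair z w"
  shows "Psi (shear h) {vtx z, vtx w} =
    (Re (L (vtx z)) + Re (L (vtx w))) / 2 - ln (stretch (vtx z) (vtx w))"
proof -
  have ne: "vtx z \<noteq> vtx w" using assms by (intro vtx_neq) (auto simp: farey_pair_def unimod_def)
  have e: "- z + w = w - z" "{vtx w, vtx z} = {vtx z, vtx w}" by auto
  have "- z - w = - (w + z)" by simp
  then have e': "vtx (- z - w) = vtx (w + z)" using vtx_minus by metis
  show ?thesis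
    using p_minus_diff_p_plus[OF assms] p_minus_diff_p_plus[OF farey_pair_rot[OF assms]] ne
      stretch_commute[of "vtx z" "vtx w"]
    by (simp add: Psi_def e e')
qed

end

section \<open>Summation over the edges\<close>

lemma summable_on_times_nonneg:
  fixes f :: "'a \<Rightarrow> real" and g :: "'b \<Rightarrow> real"
  assumes "f summable_on A" "g summable_on B" "\<And>x. f x \<ge> 0" "\<And>y. g y \<ge> 0"
  shows "(\<lambda>(x, y). f x * g y) summable_on A \<times> B"
proof (rule summable_on_SigmaI[where g = "\<lambda>x. f x * infsum g B"])
  show "((\<lambda>y. case (x, y) of (x, y) \<Rightarrow> f x * g y) has_sum f x * infsum g B) B" for x
    using has_sum_cmult_right[OF has_sum_infsum[OF assms(2)], of "f x"] by simp
  show "(\<lambda>x. f x * infsum g B) summable_on A"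
    by (rule summable_on_cmult_left[OF assms(1)])
qed (use assms in auto)

text \<open>This discards the finitely many indices of long edges, about which
  \<open>ln_stretch_approx\<close> says nothing.\<close>

lemma finite_summable_on_ge:
  fixes f :: "'a \<Rightarrow> real"
  assumes "f summable_on A" "\<And>x. x \<in> A \<Longrightarrow> f x \<ge> 0" "\<epsilon> > 0"
  shows "finite {x \<in> A. f x \<ge> \<epsilon>}"
proof -
  have "card G \<le> nat \<lfloor>infsum f A / \<epsilon>\<rfloor>" if G: "G \<subseteq> {x \<in> A. f x \<ge> \<epsilon>}" "finite G" for G
  proof -
    have "real (card G) * \<epsilon> \<le> sum f G" using G sum_bounded_below[of G \<epsilon> f] by auto
    also have "\<dots> \<le> infsum f A" using G assms by (intro finite_sum_le_infsum) auto
    finally have "real (card G) \<le> infsum f A / \<epsilon>" using assms(3) by (simp add: field_simps)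
    then show ?thesis by (simp add: le_nat_iff le_floor_iff)
  qed
  then show ?thesis using finite_if_finite_subsets_card_bdd by blast
qed

lemma summable_on_int_powr:
  assumes "\<beta> > 1"
  shows "(\<lambda>k::int. (1 + \<bar>of_int k\<bar>) powr - \<beta> :: real) summable_on UNIV"
proof -
  define f where "f = (\<lambda>k::int. (1 + \<bar>of_int k\<bar>) powr - \<beta> :: real)"
  have "summable (\<lambda>n. real n powr - \<beta>)" using assms by (simp add: summable_real_powr_iff)
  then have "summable (\<lambda>n. real (Suc n) powr - \<beta>)" by (subst summable_Suc_iff)
  then have s: "(\<lambda>n::nat. (1 + real n) powr - \<beta>) summable_on UNIV"
    by (subst summable_on_UNIV_nonneg_real_iff) (auto simp: add.commute)
  have "f summable_on range int"
    using s by (subst summable_on_reindex) (auto simp: f_def o_def)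
  moreover have "f summable_on range (\<lambda>n. - int n)"
    using s by (subst summable_on_reindex) (auto simp: f_def o_def inj_def)
  ultimately have "f summable_on (range int \<union> range (\<lambda>n. - int n))" by (rule summable_on_union)
  moreover have "range int \<union> range (\<lambda>n. - int n) = UNIV"
  proof -
    have "k \<in> range int \<union> range (\<lambda>n. - int n)" for k by (cases k rule: int_cases2) auto
    then show ?thesis by blast
  qed
  ultimately show ?thesis by (simp add: f_def)
qed

section \<open>Edges coded by triples of integers\<close>

definition edge_index :: "(complex \<times> complex) set" where
  "edge_index = {(z, w). farey_pair z w \<and> cmod z \<le> cmod w}"

text \<open>For fixed \<open>z\<close>, the \<open>w\<close> with \<open>cross z w = 1\<close> form one coset of the multiples of \<open>z\<close>, so the
  integer part of the coefficient of the projection of \<open>w\<close> to \<open>z\<close> identifies \<open>w\<close>.\<close>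

definition edge_code :: "complex \<times> complex \<Rightarrow> int \<times> int \<times> int" where
  "edge_code = (\<lambda>(z, w). (\<lfloor>Re z\<rfloor>, \<lfloor>Im z\<rfloor>, \<lfloor>Re (cnj z * w) / (cmod z)\<^sup>2\<rfloor>))"

text \<open>Ordering each pair by modulus loses no edge, because \<open>farey_pair_rot\<close>
  exchanges the vectors. The order makes \<open>cmod w / cmod z\<close> at least 1, which absorbs
  the rounding in the code.\<close>

lemma farey_edges_index: "farey_edges \<subseteq> (\<lambda>(z, w). {vtx z, vtx w}) ` edge_index"
proof
  fix e assume "e \<in> farey_edges"
  then obtain z w where p: "farey_pair z w" "e = {vtx z, vtx w}" using farey_edge_iff by blast
  show "e \<in> (\<lambda>(z, w). {vtx z, vtx w}) ` edge_index"
  proof (cases "cmod z \<le> cmod w")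
    case True
    then have "(z, w) \<in> edge_index" using p by (simp add: edge_index_def)
    then show ?thesis using p by force
  next
    case False
    then have "(w, - z) \<in> edge_index" using farey_pair_rot[OF p(1)] by (simp add: edge_index_def)
    then show ?thesis using p by (intro image_eqI[of _ _ "(w, - z)"]) auto
  qed
qed

lemma inj_edge_code: "inj_on edge_code edge_index"
proof (rule inj_onI, clarify)
  fix z w z' w'
  assume "(z, w) \<in> edge_index" "(z', w') \<in> edge_index" and c: "edge_code (z, w) = edge_code (z', w')"
  then have u: "unimod z w" "unimod z' w'" by (auto simp: edge_index_def farey_pair_def)
  have z: "z' = z"
    using u c by (auto simp: unimod_def gauss_def edge_code_def complex_eq_iff elim!: Ints_cases)
  obtain m where m: "w' = w + of_int m * z" using unimod_unique[of z w w'] u z by blast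
  have "Re (cnj z * w') = Re (cnj z * w) + of_int m * (cmod z)\<^sup>2"
    unfolding m cmod_power2 by (simp add: algebra_simps power2_eq_square)
  then have "Re (cnj z * w') / (cmod z)\<^sup>2 = Re (cnj z * w) / (cmod z)\<^sup>2 + of_int m"
    using unimod_neq_0[OF u(1)] by (simp only:) (simp add: field_simps)
  then have "m = 0" using c z by (simp add: edge_code_def del: complex_cnj_mult times_complex.sel)
  then show "z = z' \<and> w = w'" using m z by simp
qed

text \<open>The length is \<open>2 / (cmod z * cmod w)\<close>. The factors with \<open>p\<close>
  and \<open>q\<close> cost \<open>4 * (cmod z)\<^sup>2\<close> and the one with \<open>k\<close>
  costs \<open>3 * (cmod w / cmod z)\<close>, whence 24 = 2 * 4 * 3.\<close>

lemma edge_code_bound: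
  assumes "(z, w) \<in> edge_index" "edge_code (z, w) = (p, q, k)"
  shows "dist (vtx z) (vtx w) * ((1 + \<bar>of_int p\<bar>) * ((1 + \<bar>of_int q\<bar>) * (1 + \<bar>of_int k\<bar>))) \<le> 24"
proof -
  have u: "unimod z w" and le: "cmod z \<le> cmod w" using assms by (auto simp: edge_index_def farey_pair_def)
  have nz: "cmod z > 0" "cmod w > 0" using unimod_neq_0[OF u] by auto
  have pq: "Re z = of_int p" "Im z = of_int q"
    using u assms(2) by (auto simp: unimod_def gauss_def edge_code_def elim!: Ints_cases)
  have n: "(cmod z)\<^sup>2 = of_int (p\<^sup>2 + q\<^sup>2)" by (simp add: cmod_power2 pq)
  have "p\<^sup>2 + q\<^sup>2 > 0" using nz(1) n by (metis of_int_0_less_iff zero_less_power)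
  then have "real_of_int (p\<^sup>2 + q\<^sup>2) \<ge> 1" by linarith
  then have n1: "1 \<le> (cmod z)\<^sup>2" using n by simp
  \<comment> \<open>Half the sum of these squares is 1 + p^2 + q^2 - |p| - |q| - |p||q|.\<close>
  have "0 \<le> (\<bar>real_of_int p\<bar> - 1)\<^sup>2" "0 \<le> (\<bar>real_of_int q\<bar> - 1)\<^sup>2" "0 \<le> (\<bar>real_of_int p\<bar> - \<bar>real_of_int q\<bar>)\<^sup>2"
    by simp_all
  then have "(1 + \<bar>real_of_int p\<bar>) * (1 + \<bar>real_of_int q\<bar>) \<le> 2 + of_int (p\<^sup>2 + q\<^sup>2)"
    by (simp add: power2_eq_square algebra_simps abs_mult_self_eq)
  then have a: "(1 + \<bar>real_of_int p\<bar>) * (1 + \<bar>real_of_int q\<bar>) \<le> 4 * (cmod z)\<^sup>2" using n n1 by linarith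
  define r where "r = Re (cnj z * w) / (cmod z)\<^sup>2"
  have "\<bar>Re (cnj z * w)\<bar> \<le> cmod z * cmod w" 
    using abs_Re_le_cmod[of "cnj z * w"] unfolding norm_mult complex_mod_cnj .
  then have "\<bar>r\<bar> \<le> cmod z * cmod w / (cmod z)\<^sup>2"
    using nz unfolding r_def abs_divide by (simp add: divide_right_mono)
  then have r: "\<bar>r\<bar> \<le> cmod w / cmod z" using nz by (simp add: power2_eq_square)
  have k: "k = \<lfloor>r\<rfloor>" using assms(2) by (simp add: edge_code_def r_def)
  have "\<bar>real_of_int k\<bar> \<le> \<bar>r\<bar> + 1" unfolding k by linarith
  moreover have "1 \<le> cmod w / cmod z" using le nz by simp
  ultimately have b: "1 + \<bar>real_of_int k\<bar> \<le> 3 * (cmod w / cmod z)" using r by linarith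
  have "(1 + \<bar>real_of_int p\<bar>) * (1 + \<bar>real_of_int q\<bar>) * (1 + \<bar>real_of_int k\<bar>)
      \<le> 4 * (cmod z)\<^sup>2 * (3 * (cmod w / cmod z))"
    by (rule mult_mono[OF a b]) auto
  also have "\<dots> = 12 * (cmod z * cmod w)" using nz by (simp add: power2_eq_square)
  finally have "(1 + \<bar>real_of_int p\<bar>) * (1 + \<bar>real_of_int q\<bar>) * (1 + \<bar>real_of_int k\<bar>) \<le> 12 * (cmod z * cmod w)" .
  then have "2 / (cmod z * cmod w) * ((1 + \<bar>real_of_int p\<bar>) * (1 + \<bar>real_of_int q\<bar>) * (1 + \<bar>real_of_int k\<bar>))
      \<le> 2 / (cmod z * cmod w) * (12 * (cmod z * cmod w))"
    by (rule mult_left_mono) simp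
  also have "\<dots> = 24" using nz by simp
  also have "2 / (cmod z * cmod w) = dist (vtx z) (vtx w)"
    using u nz by (subst dist_vtx) (auto simp: unimod_def)
  finally show ?thesis by (simp only: mult.assoc)
qed

text \<open>Comparison with a product of three copies of the series of
  \<open>(1 + |k|) powr - \<beta>\<close>, pulled back along the injective code.\<close>

lemma summable_on_edge_index:
  assumes "\<beta> > 1"
  shows "(\<lambda>(z, w). dist (vtx z) (vtx w) powr \<beta>) summable_on edge_index"
proof -
  define f where "f = (\<lambda>k::int. (1 + \<bar>of_int k\<bar>) powr - \<beta> :: real)"
  define g where "g = (\<lambda>(p, q, k). f p * (f q * f k))"
  have f: "f summable_on UNIV" using summable_on_int_powr[OF assms] by (simp add: f_def)
  have nn: "f k \<ge> 0" for k by (simp add: f_def)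
  have "(\<lambda>(q, k). f q * f k) summable_on UNIV \<times> UNIV"
    by (rule summable_on_times_nonneg[OF f f nn nn])
  then have "(\<lambda>(p, y). f p * (case y of (q, k) \<Rightarrow> f q * f k)) summable_on UNIV \<times> (UNIV \<times> UNIV)"
    using nn by (intro summable_on_times_nonneg f) auto
  then have "g summable_on UNIV" by (simp add: g_def case_prod_unfold)
  then have "g summable_on edge_code ` edge_index" by (rule summable_on_subset) auto
  then have "(\<lambda>i. g (edge_code i)) summable_on edge_index"
    by (subst (asm) summable_on_reindex[OF inj_edge_code]) (simp add: o_def)
  then have "(\<lambda>i. 24 powr \<beta> * g (edge_code i)) summable_on edge_index"
    by (rule summable_on_cmult_right)
  then show ?thesis
  proof (rule summable_on_comparison_test)
    fix i assume i: "i \<in> edge_index"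
    obtain z w where zw: "i = (z, w)" by (cases i)
    obtain p q k where c: "edge_code (z, w) = (p, q, k)" by (cases "edge_code (z, w)")
    define P where "P = (1 + \<bar>real_of_int p\<bar>) * ((1 + \<bar>real_of_int q\<bar>) * (1 + \<bar>real_of_int k\<bar>))"
    have P: "P > 0" by (simp add: P_def add_pos_nonneg)
    have "dist (vtx z) (vtx w) \<le> 24 * inverse P"
      using edge_code_bound[OF i[unfolded zw] c] P unfolding P_def[symmetric] by (simp add: field_simps)
    then have "dist (vtx z) (vtx w) powr \<beta> \<le> (24 * inverse P) powr \<beta>"
      using assms by (intro powr_mono2) auto
    also have "\<dots> = 24 powr \<beta> * P powr - \<beta>"
      using P by (simp add: powr_mult powr_minus inverse_powr)
    also have "P powr - \<beta> = g (p, q, k)"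
      by (simp add: P_def g_def f_def powr_mult)
    finally show "(case i of (z, w) \<Rightarrow> dist (vtx z) (vtx w) powr \<beta>) \<le> 24 powr \<beta> * g (edge_code i)"
      by (simp add: zw c)
    show "0 \<le> (case i of (z, w) \<Rightarrow> dist (vtx z) (vtx w) powr \<beta>)" by (simp add: zw)
  qed
qed

lemma (in smooth_circle_map) shear_in_H:
  assumes "\<alpha> > 1 / 2"
  shows "shear h \<in> shear_H"
proof -
  define F where "F = (\<lambda>(z, w). {vtx z, vtx w})"
  define d where "d = (\<lambda>(z, w). dist (vtx z) (vtx w) powr (2 * \<alpha>))"
  obtain K where K: "K \<ge> 0" "\<And>a b. \<lbrakk>a \<in> unit_circle; b \<in> unit_circle; a \<noteq> b; K * dist a b powr \<alpha> \<le> 1\<rbrakk> \<Longrightarrow>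
    \<bar>(Re (L a) + Re (L b)) / 2 - ln (stretch a b)\<bar> \<le> K * dist a b powr \<alpha>"
    using ln_stretch_approx by metis
  have d: "d summable_on edge_index"
    using summable_on_edge_index[of "2 * \<alpha>"] assms by (simp add: d_def)
  \<comment> \<open>Chosen so that \<open>d i < \<epsilon>\<close> forces
    \<open>(K + 1) * D < 1\<close>, the smallness required by \<open>ln_stretch_approx\<close>;
    \<open>K\<close> itself may be 0.\<close>
  define \<epsilon> where "\<epsilon> = (1 / (K + 1))\<^sup>2"
  define B where "B = {i \<in> edge_index. d i \<ge> \<epsilon>}"
  have "\<epsilon> > 0" using K(1) by (simp add: \<epsilon>_def)
  then have "finite B" unfolding B_def by (intro finite_summable_on_ge d) (auto simp: d_def)
  have "(\<lambda>i. K\<^sup>2 * d i) summable_on edge_index - B"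
    by (intro summable_on_cmult_right summable_on_subset[OF d]) auto
  then have "(\<lambda>i. (Psi (shear h) (F i))\<^sup>2) summable_on edge_index - B"
  proof (rule summable_on_comparison_test)
    fix i assume i: "i \<in> edge_index - B"
    obtain z w where zw: "i = (z, w)" by (cases i)
    define D where "D = dist (vtx z) (vtx w) powr \<alpha>"
    have p: "farey_pair z w" "unimod z w" using i by (auto simp: zw edge_index_def farey_pair_def)
    have dD: "d i = D\<^sup>2" by (simp add: d_def zw D_def power2_eq_square powr_add[symmetric])
    then have "D\<^sup>2 < (1 / (K + 1))\<^sup>2" using i by (auto simp: B_def \<epsilon>_def)
    then have "D < 1 / (K + 1)" by (rule power_less_imp_less_base) (use K(1) in simp)
    then have "(K + 1) * D < 1" using K(1) by (simp add: field_simps)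
    moreover have "D \<ge> 0" by (simp add: D_def)
    ultimately have KD: "K * D \<le> 1" by (simp add: algebra_simps)
    have "vtx z \<in> unit_circle" "vtx w \<in> unit_circle" "vtx z \<noteq> vtx w"
      using unimod_neq_0[OF p(2)] p(2) by (auto simp: norm_vtx unimod_def intro!: vtx_neq)
    from K(2)[OF this] KD have "\<bar>Psi (shear h) (F i)\<bar> \<le> K * D"
      unfolding F_def zw D_def[symmetric] by (simp add: Psi_shear[OF p(1)])
    then have "(Psi (shear h) (F i))\<^sup>2 \<le> (K * D)\<^sup>2" by (rule power2_le_iff_abs_le[THEN iffD2, rotated]) (use K(1) \<open>D \<ge> 0\<close> in auto)
    then show "(Psi (shear h) (F i))\<^sup>2 \<le> K\<^sup>2 * d i" by (simp add: dD power_mult_distrib)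
  qed auto
  then have "(\<lambda>i. (Psi (shear h) (F i))\<^sup>2) summable_on (edge_index - B) \<union> B"
    by (rule summable_on_union[OF _ summable_on_finite[OF \<open>finite B\<close>]])
  then have s: "(\<lambda>i. (Psi (shear h) (F i))\<^sup>2) summable_on edge_index" by (rule summable_on_subset) auto
  have "farey_edges \<subseteq> F ` edge_index" using farey_edges_index by (simp add: F_def)
  \<comment> \<open>\<open>F\<close> is not injective, as \<open>(z, w)\<close> and
    \<open>(- z, - w)\<close> give the same edge, so one index is selected for each edge.\<close>
  then obtain I where I: "I \<subseteq> edge_index" "inj_on F I" "farey_edges = F ` I"
    by (metis subset_image_inj)
  have "(\<lambda>e. (Psi (shear h) e)\<^sup>2) summable_on farey_edges"
    unfolding I(3) summable_on_reindex[OF I(2)] o_def by (rule summable_on_subset[OF s I(1)])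
  then show ?thesis using shear_in_P by (simp add: shear_H_def)
qed

section \<open>A circle map with a square root cusp\<close>

text \<open>In the angle \<open>t\<close>, \<open>cusp\<close> is \<open>\<bar>sin (2 * t)\<bar> powr (3 / 2) / 6\<close>, since \<open>sqrt\<close> is an odd function on
  the reals; \<open>cusp_slope\<close> is its derivative.\<close>

definition cusp :: "complex \<Rightarrow> real" where
  "cusp z = 2 * Re z * Im z * sqrt (2 * Re z * Im z) / 6"

definition cusp_slope :: "complex \<Rightarrow> real" where
  "cusp_slope z = sqrt (2 * Re z * Im z) * ((Re z)\<^sup>2 - (Im z)\<^sup>2) / 2"

definition cusp_map :: "complex \<Rightarrow> complex" where
  "cusp_map z = z * cis (cusp z)"

definition cusp_log :: "complex \<Rightarrow> complex" where
  "cusp_log z = Complex (ln (1 + cusp_slope z)) (cusp z)"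

definition cusp_angle :: "real \<Rightarrow> real" where
  "cusp_angle t = t + cusp (cis t)"

lemma cis_double:
  "2 * Re (cis t) * Im (cis t) = sin (2 * t)" "(Re (cis t))\<^sup>2 - (Im (cis t))\<^sup>2 = cos (2 * t)"
  by (simp_all add: sin_double cos_double)

lemma cusp_cis: "cusp (cis t) = sin (2 * t) * sqrt (sin (2 * t)) / 6"
  unfolding cusp_def cis_double ..

lemma cusp_slope_cis: "cusp_slope (cis t) = sqrt (sin (2 * t)) * cos (2 * t) / 2"
  unfolding cusp_slope_def cis_double ..

lemma cusp_map_cis: "cusp_map (cis t) = cis (cusp_angle t)"
  by (simp add: cusp_map_def cusp_angle_def cis_mult)

text \<open>At 0 the difference quotient is \<open>sqrt\<close> itself and tends to 0. Elsewhere the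
  product rule applies, with the sign change of the odd \<open>sqrt\<close> taken into
  account.\<close>

lemma has_real_derivative_mult_sqrt:
  "((\<lambda>x. x * sqrt x) has_real_derivative 3 / 2 * sqrt x) (at x)"
proof (cases "x = 0")
  case True
  have "(\<lambda>y. y * sqrt y / y) \<midarrow>0\<rightarrow> 0 \<longleftrightarrow> sqrt \<midarrow>0\<rightarrow> 0"
    by (rule filterlim_cong) (auto simp: eventually_at_filter)
  moreover have "sqrt \<midarrow>0\<rightarrow> sqrt 0" by (intro isContD isCont_real_sqrt)
  ultimately show ?thesis using True by (simp add: has_field_derivative_iff)
next
  case False
  have d: "((\<lambda>x. x * sqrt x) has_real_derivative (x * ((if x > 0 then inverse (sqrt x) / 2 else - inverse (sqrt x) / 2)) + 1 * sqrt x)) (at x)"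
    using False by (intro DERIV_mult' DERIV_ident DERIV_real_sqrt_generic) auto
  have e: "x * (if x > 0 then inverse (sqrt x) / 2 else - inverse (sqrt x) / 2) + 1 * sqrt x = 3 / 2 * sqrt x"
  proof -
    have "sqrt x * sqrt x = \<bar>x\<bar>" "sqrt x \<noteq> 0" using False by simp_all
    then show ?thesis by (auto simp: field_simps)
  qed
  show ?thesis using d unfolding e .
qed

lemma cusp_cis_deriv: "((\<lambda>t. cusp (cis t)) has_real_derivative cusp_slope (cis t)) (at t)"
proof -
  have "((\<lambda>t. sin (2 * t) * sqrt (sin (2 * t))) has_real_derivative (3 / 2 * sqrt (sin (2 * t))) * (2 * cos (2 * t))) (at t)"
    by (rule DERIV_chain2[OF has_real_derivative_mult_sqrt]) (auto intro!: derivative_eq_intros)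
  from DERIV_cdivide[OF this, of 6] show ?thesis
    unfolding cusp_cis cusp_slope_cis by (simp add: field_simps)
qed

text \<open>The factor 1/6 in \<open>cusp\<close> is made for this: the slope stays away from -1, so
  the angle map increases and \<open>ln (1 + x)\<close> is Lipschitz on its range.\<close>

lemma cusp_slope_bound: "\<bar>cusp_slope (cis t)\<bar> \<le> 1 / 2"
proof -
  have "\<bar>sqrt (sin (2 * t))\<bar> * \<bar>cos (2 * t)\<bar> \<le> 1 * 1"
    by (intro mult_mono) (simp_all add: real_sqrt_abs'[symmetric])
  then show ?thesis by (simp add: cusp_slope_cis abs_mult)
qed

lemma cusp_angle_deriv: "(cusp_angle has_real_derivative 1 + cusp_slope (cis t)) (at t)"
  unfolding cusp_angle_def by (intro DERIV_add DERIV_ident cusp_cis_deriv)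

lemma continuous_cusp_angle: "continuous_on S cusp_angle"
  using cusp_angle_deriv by (intro continuous_at_imp_continuous_on ballI DERIV_isCont)

lemma strict_mono_cusp_angle: "strict_mono cusp_angle"
proof (rule strict_monoI)
  fix s t :: real assume "s < t"
  then show "cusp_angle s < cusp_angle t"
  proof (rule DERIV_pos_imp_increasing)
    fix x
    have "1 + cusp_slope (cis x) > 0" using cusp_slope_bound[of x] by linarith
    then show "\<exists>y. (cusp_angle has_real_derivative y) (at x) \<and> 0 < y" using cusp_angle_deriv by blast
  qed
qed

lemma cusp_angle_periodic: "cusp_angle (t + 2 * pi) = cusp_angle t + 2 * pi"
proof -
  have "cis (t + 2 * pi) = cis t" by (simp add: complex_eq_iff)
  then show ?thesis by (simp add: cusp_angle_def)
qed

lemma circle_homeo_cusp_map: "circle_homeo_op cusp_map"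
proof -
  have surj: "\<exists>t. cusp_angle t = y" for y
  proof -
    have a: "\<bar>cusp (cis t)\<bar> \<le> 1" for t
    proof -
      have "\<bar>sin (2 * t)\<bar> * \<bar>sqrt (sin (2 * t))\<bar> \<le> 1 * 1"
        by (intro mult_mono) (simp_all add: real_sqrt_abs'[symmetric])
      then show ?thesis by (simp add: cusp_cis abs_mult)
    qed
    have "\<exists>t\<ge>y - 1. t \<le> y + 1 \<and> cusp_angle t = y"
      using a[of "y - 1"] a[of "y + 1"] by (intro IVT' continuous_cusp_angle) (auto simp: cusp_angle_def)
    then show ?thesis by blast
  qed
  have "continuous_on unit_circle cusp_map"
    unfolding cusp_map_def cusp_def by (intro continuous_intros) simp_all
  moreover have "cusp_map ` unit_circle = unit_circle"
  proof (intro equalityI subsetI)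
    fix w assume "w \<in> unit_circle"
    then obtain y where y: "w = cis y" using circle_eq_cis[of w] by auto
    obtain t where "cusp_angle t = y" using surj by blast
    then have "w = cusp_map (cis t)" using y by (simp add: cusp_map_cis)
    then show "w \<in> cusp_map ` unit_circle" by simp
  qed (auto simp: cusp_map_def norm_mult)
  moreover have "inj_on cusp_map unit_circle"
  proof (rule inj_onI, rule ccontr)
    fix a b assume ab: "a \<in> unit_circle" "b \<in> unit_circle" "cusp_map a = cusp_map b" "a \<noteq> b"
    obtain s where s: "a = cis s" using circle_eq_cis[of a] ab by auto
    obtain t where t: "b = cis t" "s < t" "t < s + 2 * pi" using circle_cis_interval[of b s] ab s by auto
    \<comment> \<open>By periodicity, an arc shorter than a full turn has an image shorter than a
      full turn.\<close>
    have "cusp_angle s < cusp_angle t" "cusp_angle t < cusp_angle s + 2 * pi"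
      using strict_mono_cusp_angle t unfolding cusp_angle_periodic[symmetric] strict_mono_def by blast+
    then have "sin ((cusp_angle t - cusp_angle s) / 2) > 0" by (intro sin_gt_zero) auto
    then have "dist (cusp_map a) (cusp_map b) > 0" by (simp add: s t cusp_map_cis dist_cis)
    with ab show False by simp
  qed
  ultimately obtain g where "homeomorphism unit_circle unit_circle cusp_map g"
    by (metis homeomorphism_compact compact_sphere)
  then show ?thesis
    unfolding circle_homeo_op_def
    using continuous_cusp_angle strict_mono_cusp_angle cusp_map_cis by blast
qed

text \<open>\<open>f w - D * w\<close> is on the circle the composition of a function of the angle with
  vanishing derivative and the angle function \<open>w \<mapsto> s + Im (Ln (w / cis s))\<close>, which is
  differentiable in the plane.\<close>

lemma has_field_derivative_circle:
  assumes "((\<lambda>t. f (cis t)) has_vector_derivative D * (\<i> * cis s)) (at s)"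
  shows "(f has_field_derivative D) (at (cis s) within unit_circle)"
proof -
  define G where "G = (\<lambda>t. f (cis t) - D * cis t)"
  define \<theta> where "\<theta> = (\<lambda>w. s + Im (Ln (w / cis s)))"
  have cis': "(cis has_vector_derivative \<i> * cis s) (at s)"
    using has_derivative_cis[of "\<lambda>x. x" "\<lambda>x. x" s UNIV]
    by (simp add: has_vector_derivative_def scaleR_conv_of_real mult_ac)
  have "(G has_vector_derivative D * (\<i> * cis s) - D * (\<i> * cis s)) (at s)"
    unfolding G_def by (intro has_vector_derivative_diff assms has_vector_derivative_mult_right cis')
  then have G: "(G has_derivative (\<lambda>x. 0)) (at s)" by (simp add: has_vector_derivative_def)
  have \<theta>s: "\<theta> (cis s) = s" by (simp add: \<theta>_def)
  have "((\<lambda>w. Ln (w / cis s)) has_field_derivative inverse (cis s / cis s) * (1 / cis s)) (at (cis s))"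
    by (rule DERIV_chain2[OF has_field_derivative_Ln]) (auto intro!: derivative_eq_intros)
  then have "((\<lambda>w. Ln (w / cis s)) has_derivative (*) (1 / cis s)) (at (cis s))"
    by (simp add: has_field_derivative_def)
  then have "(\<theta> has_derivative (\<lambda>x. Im (1 / cis s * x))) (at (cis s))"
    unfolding \<theta>_def by (auto intro!: derivative_eq_intros)
  then have "((\<lambda>w. G (\<theta> w)) has_derivative (\<lambda>x. 0)) (at (cis s))"
    using has_derivative_compose[of \<theta> _ "cis s" UNIV G] G \<theta>s by simp
  then have Gw: "((\<lambda>w. G (\<theta> w)) has_derivative (\<lambda>x. 0)) (at (cis s) within unit_circle)"
    by (rule has_derivative_at_withinI)
  have on_circle: "G (\<theta> w) = f w - D * w" if "w \<in> unit_circle" for w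
  proof -
    have "cmod (w / cis s) = 1" using that by (simp add: norm_divide)
    then have "exp (\<i> * of_real (Im (Ln (w / cis s)))) = w / cis s"
      by (metis Arg_eq_Im_Ln Arg_eq mult.left_neutral norm_zero of_real_1 zero_neq_one)
    then have "cis (\<theta> w) = w" unfolding \<theta>_def cis_mult[symmetric] by (simp add: cis_conv_exp)
    then show ?thesis by (simp add: G_def)
  qed
  have "((\<lambda>w. f w - D * w) has_derivative (\<lambda>x. 0)) (at (cis s) within unit_circle)"
    by (rule has_derivative_transform[OF _ _ Gw]) (simp_all add: on_circle)
  then have "((\<lambda>w. f w - D * w) has_field_derivative 0) (at (cis s) within unit_circle)"
    by (simp add: has_field_derivative_def lambda_zero)
  then have "((\<lambda>w. (f w - D * w) + D * w) has_field_derivative 0 + D) (at (cis s) within unit_circle)"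
    by (intro DERIV_add) (auto intro!: derivative_eq_intros)
  then show ?thesis by simp
qed

lemma cusp_map_deriv:
  assumes "z \<in> unit_circle"
  shows "(cusp_map has_field_derivative exp (cusp_log z)) (at z within unit_circle)"
proof -
  obtain s where s: "z = cis s" using circle_eq_cis[of z] assms by auto
  have pos: "1 + cusp_slope (cis s) > 0" using cusp_slope_bound[of s] by linarith
  \<comment> \<open>The derivative along the circle must carry the velocity
    \<open>\<i> * cis s\<close> of the point to the velocity of its image.\<close>
  have e: "exp (cusp_log z) * (\<i> * cis s) = of_real (1 + cusp_slope (cis s)) * (\<i> * cis (cusp_angle s))"
    using pos by (simp add: cusp_log_def exp_eq_polar s cusp_angle_def cis_mult[symmetric] mult_ac)
  have "(cusp_angle has_derivative (*) (1 + cusp_slope (cis s))) (at s)"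
    using cusp_angle_deriv by (simp add: has_field_derivative_def)
  then have "((\<lambda>t. cis (cusp_angle t)) has_derivative
      (\<lambda>x. ((1 + cusp_slope (cis s)) * x) *\<^sub>R (\<i> * cis (cusp_angle s)))) (at s)"
    by (rule has_derivative_cis)
  then have "((\<lambda>t. cusp_map (cis t)) has_vector_derivative exp (cusp_log z) * (\<i> * cis s)) (at s)"
    unfolding e cusp_map_cis has_vector_derivative_def by (simp add: scaleR_conv_of_real mult_ac)
  then show ?thesis unfolding s by (rule has_field_derivative_circle)
qed

section \<open>Hoelder exponent of the cusp map\<close>

lemma abs_sqrt_diff_le: "\<bar>sqrt a - sqrt b\<bar> \<le> 2 * sqrt \<bar>a - b\<bar>"
proof -
  have *: "\<bar>sqrt a - sqrt b\<bar> \<le> 2 * sqrt \<bar>a - b\<bar>" if "b \<le> a" for a b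
  proof -
    have ab: "\<bar>a - b\<bar> = a - b" "sqrt b \<le> sqrt a" "0 \<le> sqrt (a - b)" using that by simp_all
    consider "0 \<le> b" | "b < 0" "0 \<le> a" | "a < 0" by linarith
    then show ?thesis unfolding ab(1)
    proof cases
      case 1
      then have "sqrt a \<le> sqrt b + sqrt (a - b)" using that sqrt_add_le_add_sqrt[of b "a - b"] by simp
      then show "\<bar>sqrt a - sqrt b\<bar> \<le> 2 * sqrt (a - b)" using ab(2,3) by linarith
    next
      \<comment> \<open>For arguments of opposite sign the two roots add up, which is what the
        factor 2 is for.\<close>
      case 2
      then have "sqrt a \<le> sqrt (a - b)" "sqrt (- b) \<le> sqrt (a - b)" by (auto intro: real_sqrt_le_mono)
      then show "\<bar>sqrt a - sqrt b\<bar> \<le> 2 * sqrt (a - b)"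
        using ab(2) unfolding real_sqrt_minus by linarith
    next
      case 3
      then have "sqrt (- b) \<le> sqrt (- a) + sqrt (a - b)" using that sqrt_add_le_add_sqrt[of "- a" "a - b"] by simp
      then show "\<bar>sqrt a - sqrt b\<bar> \<le> 2 * sqrt (a - b)"
        using ab(2,3) unfolding real_sqrt_minus by linarith
    qed
  qed
  show ?thesis using *[of a b] *[of b a] by (cases "b \<le> a") (auto simp: abs_minus_commute)
qed

lemma abs_ln_diff_le:
  fixes x y :: real
  assumes "\<bar>x\<bar> \<le> 1 / 2" "\<bar>y\<bar> \<le> 1 / 2"
  shows "\<bar>ln (1 + x) - ln (1 + y)\<bar> \<le> 2 * \<bar>x - y\<bar>"
proof -
  have "norm (ln (1 + x) - ln (1 + y)) \<le> 2 * norm (x - y)"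
  proof (rule field_differentiable_bound[of "{-(1 / 2)..1 / 2}" "\<lambda>x. ln (1 + x)" "\<lambda>x. 1 / (1 + x)"])
    show "((\<lambda>x. ln (1 + x)) has_field_derivative 1 / (1 + z)) (at z within {-(1 / 2)..1 / 2})"
      if "z \<in> {-(1 / 2)..1 / 2}" for z :: real
      using that by (auto intro!: derivative_eq_intros)
    show "norm (1 / (1 + z)) \<le> 2" if "z \<in> {-(1 / 2)..1 / 2}" for z :: real
      using that by (auto simp: field_simps)
  qed (use assms in auto)
  then show ?thesis by simp
qed

lemma abs_sin_diff_le: "\<bar>sin x - sin y\<bar> \<le> \<bar>x - y\<bar>" for x y :: real
  using field_differentiable_bound[of UNIV sin cos 1 x y] by (auto intro!: derivative_eq_intros)

lemma abs_cos_diff_le: "\<bar>cos x - cos y\<bar> \<le> \<bar>x - y\<bar>" for x y :: real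
  using field_differentiable_bound[of UNIV cos "\<lambda>x. - sin x" 1 x y] by (auto intro!: derivative_eq_intros)

text \<open>Only the root is not Lipschitz. Angles differ by at most 4, so a Lipschitz term
  \<open>x\<close> is at most \<open>2 * sqrt x\<close>. The real part contributes 8, the imaginary
  part 1, and passing from arc to chord doubles the sum.\<close>

lemma cusp_log_holder_half:
  assumes "z \<in> unit_circle" "w \<in> unit_circle"
  shows "dist (cusp_log z) (cusp_log w) \<le> 18 * sqrt (dist z w)"
proof -
  obtain s where s: "z = cis s" using circle_eq_cis[of z] assms by auto
  obtain t where t: "w = cis t" "\<bar>t - s\<bar> \<le> 2 * dist (cis s) w"
    using circle_chord[of w s] assms(2) by auto
  define x where "x = \<bar>t - s\<bar>"
  have x: "0 \<le> x" "x \<le> 2 * dist z w" using t s by (auto simp: x_def)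
  have x2: "\<bar>2 * s - 2 * t\<bar> = 2 * x" by (simp add: x_def abs_if)
  have "dist z w \<le> 2" using dist_triangle[of z w 0] assms by simp
  then have "x \<le> 4" using x by linarith
  then have "sqrt x * sqrt x \<le> 2 * sqrt x"
    using x(1) real_sqrt_le_mono[of x 4] by (intro mult_right_mono) auto
  then have xs: "x \<le> 2 * sqrt x" using x(1) by simp
  have a: "\<bar>sqrt (sin (2 * s)) - sqrt (sin (2 * t))\<bar> \<le> 2 * sqrt (2 * x)"
  proof -
    have "\<bar>sin (2 * s) - sin (2 * t)\<bar> \<le> 2 * x" using abs_sin_diff_le[of "2 * s" "2 * t"] x2 by simp
    then have "sqrt \<bar>sin (2 * s) - sin (2 * t)\<bar> \<le> sqrt (2 * x)" by (rule real_sqrt_le_mono)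
    then show ?thesis using abs_sqrt_diff_le[of "sin (2 * s)" "sin (2 * t)"] by linarith
  qed
  have b: "\<bar>cos (2 * s) - cos (2 * t)\<bar> \<le> 2 * x" using abs_cos_diff_le[of "2 * s" "2 * t"] x2 by simp
  have u: "\<bar>cusp_slope z - cusp_slope w\<bar> \<le> 4 * sqrt x"
  proof -
    have "sqrt (sin (2 * s)) * cos (2 * s) - sqrt (sin (2 * t)) * cos (2 * t) =
      (sqrt (sin (2 * s)) - sqrt (sin (2 * t))) * cos (2 * s) + sqrt (sin (2 * t)) * (cos (2 * s) - cos (2 * t))"
      by (simp add: algebra_simps)
    also have "\<bar>\<dots>\<bar> \<le> \<bar>sqrt (sin (2 * s)) - sqrt (sin (2 * t))\<bar> * \<bar>cos (2 * s)\<bar> + \<bar>sqrt (sin (2 * t))\<bar> * \<bar>cos (2 * s) - cos (2 * t)\<bar>"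
      by (rule order_trans[OF abs_triangle_ineq]) (simp add: abs_mult)
    also have "\<dots> \<le> 2 * sqrt (2 * x) * 1 + 1 * (2 * x)"
      using a b x(1) by (intro add_mono mult_mono) (simp_all add: real_sqrt_abs'[symmetric])
    finally have "\<bar>cusp_slope z - cusp_slope w\<bar> \<le> sqrt (2 * x) + x"
      by (simp add: s t(1) cusp_slope_cis)
    moreover have "sqrt (2 * x) \<le> 2 * sqrt x"
      using x(1) real_sqrt_le_mono[of 2 4] by (simp add: real_sqrt_mult mult_right_mono)
    ultimately show ?thesis using xs by linarith
  qed
  have r: "\<bar>ln (1 + cusp_slope z) - ln (1 + cusp_slope w)\<bar> \<le> 8 * sqrt x"
    using abs_ln_diff_le[OF cusp_slope_bound cusp_slope_bound, of s t] u by (simp add: s t(1))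
  have "norm (cusp (cis s) - cusp (cis t)) \<le> 1 / 2 * norm (s - t)"
    by (rule field_differentiable_bound[of UNIV "\<lambda>t. cusp (cis t)" "\<lambda>t. cusp_slope (cis t)"])
       (use cusp_cis_deriv cusp_slope_bound in auto)
  then have i: "\<bar>cusp z - cusp w\<bar> \<le> sqrt x" using xs by (simp add: s t(1) x_def abs_minus_commute)
  have "dist (cusp_log z) (cusp_log w) \<le> 9 * sqrt x"
    using cmod_le[of "cusp_log z - cusp_log w"] r i by (simp add: dist_norm cusp_log_def)
  moreover have "sqrt x \<le> 2 * sqrt (dist z w)"
    using real_sqrt_le_mono[of x "4 * dist z w"] x by (simp add: real_sqrt_mult)
  ultimately show ?thesis by linarith
qed

text \<open>One map serves all exponents up to 1/2: distances are at most 2, so the left-over power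
  is at most 2 and doubles the constant 18.\<close>

lemma cusp_smooth_circle_map:
  fixes \<alpha> :: real
  assumes "0 < \<alpha>" "\<alpha> \<le> 1 / 2"
  shows "smooth_circle_map cusp_map cusp_log \<alpha> 36"
proof
  fix z w assume zw: "z \<in> unit_circle" "w \<in> unit_circle"
  have d: "dist z w \<le> 2" using dist_triangle[of z w 0] zw by simp
  show "dist (cusp_log z) (cusp_log w) \<le> 36 * dist z w powr \<alpha>"
  proof (cases "z = w")
    case False
    have "sqrt (dist z w) = dist z w powr \<alpha> * dist z w powr (1 / 2 - \<alpha>)"
      using False by (simp add: powr_add[symmetric] powr_half_sqrt)
    also have "\<dots> \<le> dist z w powr \<alpha> * 2 powr 1"
    proof (rule mult_left_mono)
      have "dist z w powr (1 / 2 - \<alpha>) \<le> 2 powr (1 / 2 - \<alpha>)" using d assms by (intro powr_mono2) auto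
      also have "\<dots> \<le> 2 powr 1" using assms by (intro powr_mono) auto
      finally show "dist z w powr (1 / 2 - \<alpha>) \<le> 2 powr 1" .
    qed simp
    finally show ?thesis using cusp_log_holder_half[OF zw] by simp
  qed simp
qed (use assms circle_homeo_cusp_map cusp_map_deriv in auto)

section \<open>Divergence along the fan of the vertex 1\<close>

lemma farey_pair_1_i: "farey_pair 1 (\<i> + of_int n)"
proof -
  have "vtx 1 = 1" "vtx \<i> = -1" "vtx (1 + \<i>) = \<i>"
    by (simp_all add: vtx_def complex_eq_iff Re_divide Im_divide)
  then have "farey_pair 1 \<i>"
    using farey_triangles.base by (simp add: farey_pair_def unimod_def gauss_def cross_eq insert_commute)
  from farey_pair_shift[OF this, of n] show ?thesis by simp
qed

text \<open>The vector \<open>\<i> + n\<close> has argument \<open>arctan (1 / n)\<close>, and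
  \<open>vtx\<close> doubles it.\<close>

lemma vtx_fan_1:
  assumes "n > 0"
  shows "vtx (\<i> + of_nat n) = cis (2 * arctan (1 / real n))"
proof -
  define t where "t = arctan (1 / real n)"
  have c: "cos t > 0" unfolding t_def by (simp add: cos_arctan add_pos_nonneg)
  have "tan t = 1 / real n" by (simp add: t_def tan_arctan)
  then have "sin t / cos t = 1 / real n" by (simp only: tan_def)
  then have "cos t = real n * sin t" using c assms by (simp add: field_simps)
  then have e: "of_real (sin t) * (\<i> + of_nat n) = cis t" by (simp add: complex_eq_iff mult.commute)
  have s: "sin t \<noteq> 0" using \<open>cos t = _\<close> c by auto
  have "vtx (\<i> + of_nat n) = (of_real (sin t) * (\<i> + of_nat n)) / cnj (of_real (sin t) * (\<i> + of_nat n))"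
    using s by (simp add: vtx_def)
  also have "\<dots> = cis (2 * t)" unfolding e by (simp add: cis_cnj cis_divide)
  finally show ?thesis by (simp add: t_def)
qed

lemma cusp_shear_not_in_H:
  fixes \<alpha> :: real
  assumes "0 < \<alpha>" "\<alpha> \<le> 1 / 2"
  shows "shear cusp_map \<notin> shear_H"
proof
  assume H: "shear cusp_map \<in> shear_H"
  interpret smooth_circle_map cusp_map cusp_log \<alpha> 36 by (rule cusp_smooth_circle_map[OF assms])
  define e where "e = (\<lambda>n::nat. {vtx 1, vtx (\<i> + of_nat n)})"
  have "inj e"
  proof -
    have "inj (\<lambda>n::int. {vtx 1, vtx (\<i> - of_int n * 1)})"
      using fan_indexing_vtx[of 1 \<i>] farey_pair_1_i[of 0] by (simp add: fan_indexing_def bij_betw_def)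
    \<comment> \<open>The points \<open>\<i> + n\<close> carry negative fan indices; they approach 1
      from the side of positive angles.\<close>
    then have "inj ((\<lambda>n::int. {vtx 1, vtx (\<i> - of_int n * 1)}) \<circ> (\<lambda>k. - int k))"
      by (intro inj_compose) (auto simp: inj_def)
    then show ?thesis by (simp add: e_def o_def)
  qed
  moreover have "e n \<in> farey_edges" for n
    unfolding farey_edge_iff e_def using farey_pair_1_i[of "int n"] by auto
  then have "range e \<subseteq> farey_edges" by blast
  then have "(\<lambda>e. (Psi (shear cusp_map) e)\<^sup>2) summable_on range e"
    using summable_on_subset H unfolding shear_H_def by blast
  ultimately have "(\<lambda>n. (Psi (shear cusp_map) (e n))\<^sup>2) summable_on UNIV"
    by (simp add: summable_on_reindex o_def)
  then have sum: "summable (\<lambda>n. (Psi (shear cusp_map) (e n))\<^sup>2)" by (rule summable_on_imp_summable)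
  \<comment> \<open>\<open>Psi\<close> on the edge from angle 0 to angle \<open>t\<close>, as an
    elementary function; the end at 0 contributes \<open>ln 1\<close>, and the sines are half
    chords.\<close>
  define q where "q = (\<lambda>t::real. ln (1 + sqrt (sin (2 * t)) * cos (2 * t) / 2) / 2
    - ln (sin ((t + sin (2 * t) * sqrt (sin (2 * t)) / 6) / 2) / sin (t / 2)))"
  define a where "a = (\<lambda>n. 2 * arctan (1 / real n))"
  have Psi_eq: "Psi (shear cusp_map) (e n) = q (a n)" if n: "n > 0" for n
  proof -
    have [simp]: "cusp 1 = 0" "cusp_slope 1 = 0" by (simp_all add: cusp_def cusp_slope_def)
    have v1: "vtx 1 = cis 0" by (simp add: vtx_def)
    have v2: "vtx (\<i> + of_nat n) = cis (a n)" using vtx_fan_1[OF n] by (simp add: a_def)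
    have an: "0 < a n" "a n < pi"
      using n arctan_ubound[of "1 / real n"] by (simp_all add: a_def)
    have "cusp_angle 0 < cusp_angle (a n)" "cusp_angle (a n) < cusp_angle (2 * pi)"
      using strict_mono_cusp_angle an pi_gt_zero unfolding strict_mono_def by (auto simp del: pi_gt_zero)
    then have "0 < cusp_angle (a n)" "cusp_angle (a n) < 2 * pi"
      by (simp_all add: cusp_angle_def[of 0] cusp_angle_def[of "2 * pi"])
    then have s: "sin (cusp_angle (a n) / 2) > 0" "sin (a n / 2) > 0"
      using an by (auto intro!: sin_gt_zero)
    have "Psi (shear cusp_map) (e n) = (Re (cusp_log (cis 0)) + Re (cusp_log (cis (a n)))) / 2
        - ln (stretch (cis 0) (cis (a n)))"
      using Psi_shear[OF farey_pair_1_i[of "int n"]] by (simp add: e_def v1 v2)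
    also have "stretch (cis 0) (cis (a n)) = sin (cusp_angle (a n) / 2) / sin (a n / 2)"
      unfolding stretch_def cusp_map_cis dist_cis using s by (simp add: cusp_angle_def[of 0])
    finally show ?thesis
      unfolding cusp_angle_def[of "a n"] by (simp add: q_def cusp_log_def cusp_slope_cis cusp_cis)
  qed
  \<comment> \<open>Near 0 the ends average to about \<open>sqrt (2 * t) / 4\<close>, while the
    stretch exceeds 1 by about \<open>sqrt (2 * t) / 3\<close>; the difference is
    \<open>- sqrt (2 * t) / 12\<close>.\<close>
  have "((\<lambda>t. (q t)\<^sup>2 / t) \<longlongrightarrow> (2 powr (1 / 2) / 12)\<^sup>2) (at_right 0)"
    unfolding q_def by real_asymp
  moreover have "filterlim a (at_right 0) sequentially" unfolding a_def by real_asymp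
  ultimately have "(\<lambda>n. (q (a n))\<^sup>2 / a n) \<longlonglongrightarrow> (2 powr (1 / 2) / 12)\<^sup>2" by (rule filterlim_compose)
  moreover have "(\<lambda>n. real n * a n) \<longlonglongrightarrow> 2" unfolding a_def by real_asymp
  ultimately have "(\<lambda>n. (q (a n))\<^sup>2 / a n * (real n * a n)) \<longlonglongrightarrow> (2 powr (1 / 2) / 12)\<^sup>2 * 2"
    by (rule tendsto_mult)
  then have "(\<lambda>n. (q (a n))\<^sup>2 / a n * (real n * a n)) \<longlonglongrightarrow> 1 / 36"
    by (simp add: powr_half_sqrt power_divide)
  \<comment> \<open>Half of the limit, so the bound holds eventually.\<close>
  then have "\<forall>\<^sub>F n in sequentially. (q (a n))\<^sup>2 / a n * (real n * a n) > 1 / 72"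
    by (rule order_tendstoD) simp
  then have "\<forall>\<^sub>F n in sequentially. norm (1 / 72 * inverse (real n)) \<le> (Psi (shear cusp_map) (e n))\<^sup>2"
    using eventually_gt_at_top[of 0]
  proof eventually_elim
    case (elim n)
    have "a n > 0" using elim(2) by (simp add: a_def)
    then have "(q (a n))\<^sup>2 * real n > 1 / 72" using elim(1) by (simp add: field_simps)
    then show ?case using elim(2) Psi_eq[OF elim(2)] by (simp add: field_simps)
  qed
  then have "summable (\<lambda>n. 1 / 72 * inverse (real n))"
    by (rule summable_comparison_test_ev[OF _ sum])
  then have "summable (\<lambda>n. inverse (real n))" by (subst (asm) summable_cmult_iff) simp
  then show False using not_summable_harmonic[where 'a = real] by simp
qed

theorem theorem4p1:
  fixes \<alpha> :: real
  assumes "0 < \<alpha>" and "\<alpha> \<le> 1"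
  shows "(\<forall>h \<in> C1_circle \<alpha>. normalized h \<longrightarrow> shear h \<in> shear_H) \<longleftrightarrow> \<alpha> > 1/2"
proof
  assume all: "\<forall>h \<in> C1_circle \<alpha>. normalized h \<longrightarrow> shear h \<in> shear_H"
  show "\<alpha> > 1/2"
  proof (rule ccontr)
    assume "\<not> \<alpha> > 1/2"
    then have \<alpha>: "\<alpha> \<le> 1 / 2" by simp
    interpret smooth_circle_map cusp_map cusp_log \<alpha> 36 by (rule cusp_smooth_circle_map[OF assms(1) \<alpha>])
    have "cusp_map \<in> C1_circle \<alpha>"
      unfolding C1_circle_def holder_on_def using homeo deriv holder by blast
    \<comment> \<open>\<open>cusp\<close> is built from \<open>2 * Re z * Im z\<close>, which
      vanishes at all three points, so the map fixes them without a Moebius correction.\<close>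
    moreover have "normalized cusp_map"
      by (simp add: normalized_def cusp_map_def cusp_def)
    ultimately show False using all cusp_shear_not_in_H[OF assms(1) \<alpha>] by blast
  qed
next
  assume \<alpha>: "\<alpha> > 1/2"
  show "\<forall>h \<in> C1_circle \<alpha>. normalized h \<longrightarrow> shear h \<in> shear_H"
  proof (intro ballI impI)
    fix h assume "h \<in> C1_circle \<alpha>"
    then obtain L C where "smooth_circle_map h L \<alpha> C" using C1_circle_imp_smooth assms(1) by blast
    then show "shear h \<in> shear_H" using \<alpha> by (rule smooth_circle_map.shear_in_H)
  qed
qed

end
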